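(* Let $H$ be a graph such that the class $\mathcal{F}_H$ of all graphs with no induced subgraph isomorphic to $H$ is clean. Then $H$ is a subdivided star forest.
   Context: All graphs are finite and simple. For an integer $t\geq 1$, the $t$-basic obstructions are: $K_t$, $K_{t,t}$, every subdivision of the $(t\times t)$-wall $W_{t\times t}$, and the line graph of every subdivision of $W_{t\times t}$, where $W_{t\times t}$ is the standard $(t\times t)$-wall (a planar hexagonal-grid-like graph of maximum degree three on $2t^2-2t$ vertices). A graph is $t$-clean if it has no induced subgraph isomorphic to a $t$-basic obstruction. A class $\mathcal{C}$ of graphs is clean if for every positive integer $t$ there exists $w(t)$ such that every $t$-clean graph in $\mathcal{C}$ has treewidth at most $w(t)$. A subdivided star forest is a forest in which every component is a tree with at most one vertex of degree more than two. *)

theory Defs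
  imports "Graph_Theory.Graph_Theory"
begin

text \<open>
  A finite simple graph is a \<^const>\<open>pair_graph\<close>: a finite, loop-free, symmetric digraph whose arcs are
  pairs of vertices, each edge being present as two opposite arcs. Hence \<^const>\<open>out_degree\<close> is the
  degree, \<^const>\<open>pre_digraph.sccs\<close> is the set of connected components, and the library's
  \<^const>\<open>complete_digraph\<close>, \<^const>\<open>complete_bipartite_digraph\<close>, \<^const>\<open>induced_subgraph\<close>,
  \<^const>\<open>digraph_iso\<close> and \<^const>\<open>subdivision\<close> are the usual notions.
  The library's \<^const>\<open>forest\<close> and \<^const>\<open>tree\<close> cannot be used: they count the walk along an edge
  and back as a cycle. Undirected cycles are those with at least three arcs.
\<close>

definition undirected_forest :: "('a, 'b) pre_digraph \<Rightarrow> bool" where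
  "undirected_forest G \<longleftrightarrow> \<not> (\<exists>p. pre_digraph.cycle G p \<and> 3 \<le> length p)"

definition undirected_tree :: "('a, 'b) pre_digraph \<Rightarrow> bool" where
  "undirected_tree G \<longleftrightarrow> Digraph_Component.connected G \<and> undirected_forest G"

definition subdivided_star_forest :: "('a, 'b) pre_digraph \<Rightarrow> bool" where
  "subdivided_star_forest G \<longleftrightarrow> undirected_forest G \<and>
     (\<forall>C \<in> pre_digraph.sccs G.
        undirected_tree C \<and> card {v \<in> verts C. 2 < out_degree C v} \<le> 1)"

definition contains_induced :: "('a, 'b) pre_digraph \<Rightarrow> ('c, 'd) pre_digraph \<Rightarrow> bool" where
  "contains_induced G H \<longleftrightarrow> (\<exists>I. induced_subgraph I G \<and> digraph_iso H I)"

definition line_graph :: "'a pair_pre_digraph \<Rightarrow> 'a set pair_pre_digraph" where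
  "line_graph G =
     (let E = {{u, v} | u v. (u, v) \<in> parcs G}
      in \<lparr> pverts = E, parcs = {(e, f) \<in> E \<times> E. e \<noteq> f \<and> e \<inter> f \<noteq> {}} \<rparr>)"

text \<open>
  The $(t \times t)$-wall has $t$ rows, numbered from 1. A row strictly between the first and the last
  is a path on the columns $1, \dots, 2t$. Rows $i$ and $i+1$ are joined in the columns of the same
  parity as $i$. The first and the last row keep only the vertices lying on such a vertical edge, every
  other column, and are paths on these; this gives $2t^2 - 2t$ vertices in total.
\<close>

definition wall_verts :: "nat \<Rightarrow> (nat \<times> nat) set" where
  "wall_verts t = {(i, j). 1 \<le> i \<and> i \<le> t \<and> 1 \<le> j \<and> j \<le> 2 * t \<and>
     (i = 1 \<longrightarrow> odd j) \<and> (i = t \<longrightarrow> odd (t + j))}"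

definition wall :: "nat \<Rightarrow> (nat \<times> nat) pair_pre_digraph" where
  "wall t = \<lparr> pverts = wall_verts t,
     parcs = symcl {((i, j), (i', j')) | i j i' j'.
       (i, j) \<in> wall_verts t \<and> (i', j') \<in> wall_verts t \<and>
       (i' = i \<and> j' = (if i = 1 \<or> i = t then j + 2 else j + 1) \<or>
        i' = i + 1 \<and> j' = j \<and> even (i + j))} \<rparr>"

text \<open>The graphs isomorphic to a \<open>t\<close>-basic obstruction.\<close>

definition basic_obstruction :: "nat \<Rightarrow> ('a, 'b) pre_digraph \<Rightarrow> bool" where
  "basic_obstruction t B \<longleftrightarrow>
     complete_digraph t B \<or>
     complete_bipartite_digraph t t B \<or>
     (\<exists>S. subdivision_pair (wall t) S \<and>
        (digraph_iso (with_proj S) B \<or> digraph_iso (with_proj (line_graph S)) B))"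

definition t_clean :: "nat \<Rightarrow> ('a, 'b) pre_digraph \<Rightarrow> bool" where
  "t_clean t G \<longleftrightarrow> \<not> (\<exists>B. induced_subgraph B G \<and> basic_obstruction t B)"

text \<open>
  Every finite tree is isomorphic to one on natural numbers, so the decomposition tree may be taken
  there. The width is a natural number: the null graph gets treewidth 0 instead of $-1$.
\<close>

definition tree_decomposition ::
    "'a pair_pre_digraph \<Rightarrow> nat pair_pre_digraph \<Rightarrow> (nat \<Rightarrow> 'a set) \<Rightarrow> bool" where
  "tree_decomposition G T \<beta> \<longleftrightarrow>
     pair_graph T \<and> undirected_tree (with_proj T) \<and>
     (\<Union>x \<in> pverts T. \<beta> x) = pverts G \<and>
     (\<forall>(u, v) \<in> parcs G. \<exists>x \<in> pverts T. u \<in> \<beta> x \<and> v \<in> \<beta> x) \<and>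
     (\<forall>v \<in> pverts G. Digraph_Component.connected (with_proj T \<restriction> {x \<in> pverts T. v \<in> \<beta> x}))"

definition decomposition_width :: "nat pair_pre_digraph \<Rightarrow> (nat \<Rightarrow> 'a set) \<Rightarrow> nat" where
  "decomposition_width T \<beta> = Max ((\<lambda>x. card (\<beta> x)) ` pverts T) - 1"

definition treewidth :: "'a pair_pre_digraph \<Rightarrow> nat" where
  "treewidth G = (LEAST w. \<exists>T \<beta>. tree_decomposition G T \<beta> \<and> decomposition_width T \<beta> = w)"

text \<open>
  Classes of finite graphs are represented by sets of graphs on natural numbers, which contain an
  isomorphic copy of every finite graph.
\<close>

definition clean_class :: "nat pair_pre_digraph set \<Rightarrow> bool" where
  "clean_class \<C> \<longleftrightarrow>
     (\<forall>t \<ge> 1. \<exists>w. \<forall>G \<in> \<C>. t_clean t (with_proj G) \<longrightarrow> treewidth G \<le> w)"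

definition free_class :: "'a pair_pre_digraph \<Rightarrow> nat pair_pre_digraph set" where
  "free_class H = {G. pair_graph G \<and> \<not> contains_induced (with_proj G) (with_proj H)}"

lemma finite_wall_verts: "finite (wall_verts t)"
  by (rule finite_subset[of _ "{..t} \<times> {..2 * t}"]) (auto simp: wall_verts_def)

lemma pair_graph_wall: "pair_graph (wall t)"
proof -
  have fin: "finite (parcs (wall t))"
    by (rule finite_subset[of _ "wall_verts t \<times> wall_verts t"])
       (auto simp: wall_def symcl_def finite_wall_verts)
  have "sym (symcl R)" for R :: "(nat \<times> nat) rel"
    unfolding symcl_def sym_def by force
  then have sym: "symmetric (with_proj (wall t))"
    by (simp add: symmetric_def wall_def)
  show ?thesis
    by unfold_locales
       (use fin sym in \<open>auto simp: wall_def symcl_def finite_wall_verts split: if_splits\<close>)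
qed

end

theory Submission
  imports Defs "HOL-Library.Nat_Bijection"
begin

text \<open>
  Take \<open>n\<close> long disjoint paths and \<open>n\<close> further vertices, the centres, each attached to every path, in
  the same order and at distance \<open>k\<close> along every path. The sets consisting of one centre and one path
  form a bramble of order \<open>n\<close>, so the treewidth is unbounded.

  These graphs are nevertheless \<open>t\<close>-clean for a constant \<open>t\<close>: a centre in an induced subgraph \<open>W\<close> of
  bounded degree meets only boundedly many paths of \<open>W\<close>, so all other paths are interrupted there.
  Ordering \<open>W\<close> along the paths gives a linear layout in which each cut has few edges and each piece few
  branching vertices. Such layouts are inherited from line graphs and from subdivisions, and a large
  wall has none.

  If a centre sees one vertex of each path, every cycle has more than \<open>k\<close> vertices. If it sees two
  consecutive vertices of each path, only centres can have degree at least three in an induced forest,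
  and centres are at distance at least \<open>k\<close>. So if \<open>H\<close> has a cycle, or is a forest with two branch
  vertices in one component, one of the two constructions with \<open>k \<ge> |H|\<close> is \<open>H\<close>-free.
\<close>

section \<open>Cuts and subdivisions\<close>

text \<open>Only the upward orientation of an edge is collected, so each undirected edge across the
  threshold counts once.\<close>

definition cut_arcs :: "'a pair_pre_digraph \<Rightarrow> ('a \<Rightarrow> nat) \<Rightarrow> nat \<Rightarrow> ('a \<times> 'a) set" where
  "cut_arcs G f c = {(u, v) \<in> parcs G. f u \<le> c \<and> c < f v}"

lemma finite_cut_arcs: "pair_graph G \<Longrightarrow> finite (cut_arcs G f c)"
  by (rule finite_subset[of _ "parcs G"])
     (auto simp: cut_arcs_def pair_fin_digraph.pair_finite_arcs pair_graph_def pair_digraph_def)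

lemma pair_graphD:
  assumes "pair_graph G"
  shows "finite (pverts G)" "finite (parcs G)" "finite (parcs G `` {v})"
    and "(u, v) \<in> parcs G \<Longrightarrow> u \<in> pverts G" "(u, v) \<in> parcs G \<Longrightarrow> v \<in> pverts G"
    and "(u, v) \<in> parcs G \<Longrightarrow> (v, u) \<in> parcs G" "(u, v) \<in> parcs G \<Longrightarrow> u \<noteq> v"
proof -
  interpret pair_graph G by fact
  show "finite (pverts G)" "finite (parcs G)"
    by (simp_all add: pair_finite_verts pair_finite_arcs)
  show "finite (parcs G `` {v})"
    using pair_finite_arcs by (rule finite_Image)
  show "(u, v) \<in> parcs G \<Longrightarrow> u \<in> pverts G" "(u, v) \<in> parcs G \<Longrightarrow> v \<in> pverts G"
    by (auto dest: wellformed')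
  show "(u, v) \<in> parcs G \<Longrightarrow> (v, u) \<in> parcs G"
    by (simp add: arcs_symmetric)
  show "(u, v) \<in> parcs G \<Longrightarrow> u \<noteq> v"
    using no_loops' by blast
qed

text \<open>Wherever \<open>f\<close> puts the new vertex, one half of a divided cut edge still
  crosses the threshold, and all other edges survive.\<close>

lemma card_cut_arcs_subdivide:
  assumes G: "pair_graph G" and e: "(u, v) \<in> parcs G" and w: "w \<notin> pverts G"
  shows "card (cut_arcs G f c) \<le> card (cut_arcs (subdivide G (u, v) w) f c)" (is "_ \<le> card (cut_arcs ?H f c)")
proof -
  have H: "pair_graph ?H"
    using G e w by (rule pair_graph.pair_graph_subdivide)
  have new: "(w, x) \<notin> parcs G" "(x, w) \<notin> parcs G" for x
    using w pair_graphD(4,5)[OF G] by auto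
  define R where "R = cut_arcs G f c - {(u, v), (v, u)}"
  have R: "R \<subseteq> cut_arcs ?H f c" "finite R" "\<And>x. (w, x) \<notin> R" "\<And>x. (x, w) \<notin> R"
    using finite_cut_arcs[OF G] new by (auto simp: R_def cut_arcs_def)
  \<comment> \<open>At most one orientation of the divided edge is in the cut, so \<open>R\<close>
    lacks at most one arc; the half edge \<open>b\<close> makes up for it.\<close>
  have one: "card (cut_arcs G f c) \<le> card (cut_arcs ?H f c)"
    if "cut_arcs G f c = insert a R" "b \<in> cut_arcs ?H f c" "b \<notin> R" for a b
  proof -
    have "card (cut_arcs G f c) \<le> Suc (card R)"
      using that(1) R(2) card_insert_le_m1 by (metis card.insert_remove card_Diff1_le Suc_le_mono)
    also have "\<dots> = card (insert b R)"
      using that R(2) by simp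
    also have "\<dots> \<le> card (cut_arcs ?H f c)"
      using that R(1) by (intro card_mono finite_cut_arcs[OF H]) auto
    finally show ?thesis .
  qed
  consider "f u \<le> c" "c < f v" | "f v \<le> c" "c < f u" | "cut_arcs G f c = R"
    by (force simp: R_def cut_arcs_def)
  then show ?thesis
  proof cases
    case 1
    have "cut_arcs G f c = insert (u, v) R"
      using 1 e by (auto simp: R_def cut_arcs_def)
    moreover have "(if f w \<le> c then (w, v) else (u, w)) \<in> cut_arcs ?H f c"
      using 1 by (auto simp: cut_arcs_def)
    ultimately show ?thesis
      by (rule one) (auto split: if_splits simp: R(3,4))
  next
    case 2
    have "cut_arcs G f c = insert (v, u) R"
      using 2 pair_graphD(6)[OF G e] by (auto simp: R_def cut_arcs_def)
    moreover have "(if f w \<le> c then (w, u) else (v, w)) \<in> cut_arcs ?H f c"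
      using 2 by (auto simp: cut_arcs_def)
    ultimately show ?thesis
      by (rule one) (auto split: if_splits simp: R(3,4))
  next
    case 3
    then show ?thesis using R(1) by (simp add: card_mono finite_cut_arcs[OF H])
  qed
qed

text \<open>At an end of the divided edge the new vertex merely takes the place of the other
  end.\<close>

lemma card_neighbours_subdivide:
  assumes G: "pair_graph G" and e: "(u, v) \<in> parcs G" and w: "w \<notin> pverts G" and x: "x \<in> pverts G"
  shows "card (parcs (subdivide G (u, v) w) `` {x}) = card (parcs G `` {x})"
proof -
  have new: "(w, y) \<notin> parcs G" "(y, w) \<notin> parcs G" for y
    using w pair_graphD(4,5)[OF G] by auto
  have "u \<noteq> v" "x \<noteq> w" "u \<noteq> w" "v \<noteq> w" "(v, u) \<in> parcs G"
    using pair_graphD(4-7)[OF G e] w x by auto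
  have swap: "card (insert w (parcs G `` {y} - {z})) = card (parcs G `` {y})" if "(y, z) \<in> parcs G" for y z
  proof -
    have "card (insert w (parcs G `` {y} - {z})) = Suc (card (parcs G `` {y} - {z}))"
      using new pair_graphD(3)[OF G] by (subst card_insert_disjoint) auto
    also have "\<dots> = card (parcs G `` {y})"
      using that pair_graphD(3)[OF G] by (intro card_Suc_Diff1) auto
    finally show ?thesis .
  qed
  consider "x = u" | "x = v" | "x \<noteq> u" "x \<noteq> v" by blast
  then show ?thesis
  proof cases
    case 1
    then have "parcs (subdivide G (u, v) w) `` {x} = insert w (parcs G `` {x} - {v})"
      using \<open>u \<noteq> v\<close> \<open>u \<noteq> w\<close> by auto
    then show ?thesis using swap e 1 by simp
  next
    case 2
    then have "parcs (subdivide G (u, v) w) `` {x} = insert w (parcs G `` {x} - {u})"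
      using \<open>u \<noteq> v\<close> \<open>v \<noteq> w\<close> by auto
    then show ?thesis using swap \<open>(v, u) \<in> parcs G\<close> 2 by simp
  next
    case 3
    then have "parcs (subdivide G (u, v) w) `` {x} = parcs G `` {x}"
      using \<open>x \<noteq> w\<close> by auto
    then show ?thesis by simp
  qed
qed

text \<open>These facts let a layout of a subdivided wall be read as one of the wall itself: undoing
  divisions does not enlarge cuts and preserves branch vertices.\<close>

lemma subdivision_pair_invariants:
  assumes "subdivision_pair G S" and "pair_graph G"
  shows "pair_graph S"
    and "pverts G \<subseteq> pverts S"
    and "\<And>v. v \<in> pverts G \<Longrightarrow> card (parcs S `` {v}) = card (parcs G `` {v})"
    and "\<And>v. v \<in> pverts S - pverts G \<Longrightarrow> card (parcs S `` {v}) \<le> 2"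
    and "\<And>f c. card (cut_arcs G f c) \<le> card (cut_arcs S f c)"
proof -
  have "pair_graph S \<and> pverts G \<subseteq> pverts S \<and>
    (\<forall>v \<in> pverts G. card (parcs S `` {v}) = card (parcs G `` {v})) \<and>
    (\<forall>v \<in> pverts S - pverts G. card (parcs S `` {v}) \<le> 2) \<and>
    (\<forall>f c. card (cut_arcs G f c) \<le> card (cut_arcs S f c))"
    using assms(1)
  proof (induction rule: subdivision_pair_induct)
    case base
    then show ?case using assms(2) by simp
  next
    case (divide e w S)
    obtain u v where e: "e = (u, v)" by (cases e)
    have S: "pair_graph S" using divide by blast
    have S': "pair_graph (subdivide S e w)"
      using S divide by (intro pair_graph.pair_graph_subdivide)
    have nb: "card (parcs (subdivide S e w) `` {x}) = card (parcs S `` {x})" if "x \<in> pverts S" for x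
      using card_neighbours_subdivide[OF S _ _ that] divide e by blast
    have "parcs (subdivide S e w) `` {w} \<subseteq> {u, v}"
      using divide pair_graphD(4,5)[OF S] by (auto simp: e)
    then have nw: "card (parcs (subdivide S e w) `` {w}) \<le> 2"
      using card_mono[of "{u, v}" "parcs (subdivide S e w) `` {w}"] by (auto simp: card_insert_if split: if_splits)
    have cut: "card (cut_arcs S f c) \<le> card (cut_arcs (subdivide S e w) f c)" for f c
      using card_cut_arcs_subdivide[OF S] divide e by blast
    show ?case
    proof (intro conjI ballI allI)
      show "pair_graph (subdivide S e w)" by fact
      show "pverts G \<subseteq> pverts (subdivide S e w)" using divide by (auto simp: e)
      show "card (parcs (subdivide S e w) `` {x}) = card (parcs G `` {x})" if "x \<in> pverts G" for x
        using that divide nb by (metis subsetD)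
      show "card (parcs (subdivide S e w) `` {x}) \<le> 2" if "x \<in> pverts (subdivide S e w) - pverts G" for x
        using that divide nb nw by (cases "x = w") (auto simp: e)
      show "card (cut_arcs G f c) \<le> card (cut_arcs (subdivide S e w) f c)" for f c
        using divide cut le_trans by blast
    qed
  qed
  then show "pair_graph S"
    and "pverts G \<subseteq> pverts S"
    and "\<And>v. v \<in> pverts G \<Longrightarrow> card (parcs S `` {v}) = card (parcs G `` {v})"
    and "\<And>v. v \<in> pverts S - pverts G \<Longrightarrow> card (parcs S `` {v}) \<le> 2"
    and "\<And>f c. card (cut_arcs G f c) \<le> card (cut_arcs S f c)"
    by blast+
qed

section \<open>Line graphs\<close>

text \<open>The triangle clause is for line graphs: an edge between a vertex of degree three and a
  leaf has only two neighbours there, but lies in a triangle.\<close>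

definition branching :: "'a pair_pre_digraph \<Rightarrow> 'a \<Rightarrow> bool" where
  "branching G v \<longleftrightarrow> 3 \<le> card (parcs G `` {v}) \<or>
     (\<exists>x y. (v, x) \<in> parcs G \<and> (v, y) \<in> parcs G \<and> (x, y) \<in> parcs G)"

lemma pverts_line_graph: "pverts (line_graph G) = {{u, v} | u v. (u, v) \<in> parcs G}"
  by (simp add: line_graph_def Let_def)

lemma parcs_line_graph:
  "(e, e') \<in> parcs (line_graph G) \<longleftrightarrow>
     e \<in> pverts (line_graph G) \<and> e' \<in> pverts (line_graph G) \<and> e \<noteq> e' \<and> e \<inter> e' \<noteq> {}"
  by (simp add: line_graph_def Let_def)

lemma pair_graph_line_graph:
  assumes "pair_graph G"
  shows "pair_graph (line_graph G)"
proof -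
  have "pverts (line_graph G) = (\<lambda>(u, v). {u, v}) ` parcs G"
    by (auto simp: pverts_line_graph)
  then have finV: "finite (pverts (line_graph G))"
    using pair_graphD(2)[OF assms] by simp
  moreover have "finite (parcs (line_graph G))"
    by (rule finite_subset[of _ "pverts (line_graph G) \<times> pverts (line_graph G)"])
       (auto simp: parcs_line_graph finV)
  moreover have "symmetric (with_proj (line_graph G))"
    by (auto simp: symmetric_def sym_def parcs_line_graph)
  ultimately show ?thesis
    by unfold_locales (auto simp: parcs_line_graph)
qed

lemma card_neighbours_line_graph:
  assumes G: "pair_graph G" and deg: "\<And>v. v \<in> pverts G \<Longrightarrow> card (parcs G `` {v}) \<le> Suc d"
    and e: "e \<in> pverts (line_graph G)"
  shows "card (parcs (line_graph G) `` {e}) \<le> 2 * d"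
proof -
  obtain u v where uv: "e = {u, v}" "(u, v) \<in> parcs G"
    using e by (auto simp: pverts_line_graph)
  have vu: "(v, u) \<in> parcs G" using pair_graphD(6)[OF G uv(2)] .
  have part: "finite ((\<lambda>x. {y, x}) ` (parcs G `` {y} - {z}))"
      "card ((\<lambda>x. {y, x}) ` (parcs G `` {y} - {z})) \<le> d" if "(y, z) \<in> parcs G" for y z
  proof -
    have fin: "finite (parcs G `` {y} - {z})"
      using pair_graphD(3)[OF G] by simp
    then show "finite ((\<lambda>x. {y, x}) ` (parcs G `` {y} - {z}))" by simp
    have "card ((\<lambda>x. {y, x}) ` (parcs G `` {y} - {z})) \<le> card (parcs G `` {y} - {z})"
      using fin by (rule card_image_le)
    also have "\<dots> = card (parcs G `` {y}) - 1"
      using that by simp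
    also have "\<dots> \<le> d"
      using deg[of y] pair_graphD(4)[OF G that] by simp
    finally show "card ((\<lambda>x. {y, x}) ` (parcs G `` {y} - {z})) \<le> d" .
  qed
  have "parcs (line_graph G) `` {e} \<subseteq>
      (\<lambda>x. {u, x}) ` (parcs G `` {u} - {v}) \<union> (\<lambda>x. {v, x}) ` (parcs G `` {v} - {u})"
  proof
    fix e' assume "e' \<in> parcs (line_graph G) `` {e}"
    then obtain x y where xy: "e' = {x, y}" "(x, y) \<in> parcs G" "(y, x) \<in> parcs G"
        and e': "e' \<noteq> e" "e' \<inter> e \<noteq> {}"
      using pair_graphD(6)[OF G] by (auto simp: parcs_line_graph pverts_line_graph)
    then consider "x = u" "y \<noteq> v" | "x = v" "y \<noteq> u" | "y = u" "x \<noteq> v" | "y = v" "x \<noteq> u"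
      using uv(1) by auto
    then show "e' \<in> (\<lambda>x. {u, x}) ` (parcs G `` {u} - {v}) \<union> (\<lambda>x. {v, x}) ` (parcs G `` {v} - {u})"
      using xy by cases (auto simp: insert_commute)
  qed
  then have "card (parcs (line_graph G) `` {e}) \<le>
      card ((\<lambda>x. {u, x}) ` (parcs G `` {u} - {v}) \<union> (\<lambda>x. {v, x}) ` (parcs G `` {v} - {u}))"
    by (intro card_mono finite_UnI part uv vu)
  also have "\<dots> \<le> d + d"
    by (intro order.trans[OF card_Un_le] add_mono part uv vu)
  finally show ?thesis by simp
qed

text \<open>Each vertex is placed at its lowest incident edge. Cut arcs of \<open>G\<close> then
  inject into those of the line graph, and a branching edge accounts for at most its two
  ends.\<close>

lemma layout_of_line_graph:
  assumes G: "pair_graph G"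
    and cut: "\<And>c. card (cut_arcs (line_graph G) f c) \<le> d"
    and fibre: "\<And>c. card {e \<in> pverts (line_graph G). branching (line_graph G) e \<and> f e = c} \<le> m"
  obtains g where "\<And>c. card (cut_arcs G g c) \<le> d"
    and "\<And>c. card {v \<in> pverts G. 3 \<le> card (parcs G `` {v}) \<and> g v = c} \<le> 2 * m"
proof -
  define inc where "inc v e \<longleftrightarrow> e \<in> pverts (line_graph G) \<and> v \<in> e" for v e
  \<comment> \<open>For an isolated vertex this value is unspecified, which is harmless: such a
    vertex lies in no arc and has degree zero.\<close>
  define g where "g v = (LEAST k. \<exists>e. inc v e \<and> f e = k)" for v
  have g_le: "g v \<le> f e" if "inc v e" for v e
    unfolding g_def using that by (intro Least_le) blast
  have g_ex: "\<exists>e'. inc v e' \<and> f e' = g v" if "inc v e" for v e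
    unfolding g_def by (rule LeastI) (use that in blast)
  define h where "h v = (SOME e. inc v e \<and> f e = g v)" for v
  have h: "inc v (h v)" "f (h v) = g v" if "inc v e" for v e
    using someI_ex[OF g_ex[OF that]] by (auto simp: h_def)
  have incI: "inc u {u, v}" "inc v {u, v}" if "(u, v) \<in> parcs G" for u v
    using that by (auto simp: inc_def pverts_line_graph)
  have L: "pair_graph (line_graph G)" using G by (rule pair_graph_line_graph)
  have "card (cut_arcs G g c) \<le> card (cut_arcs (line_graph G) f c)" for c
  proof (rule card_inj_on_le)
    \<comment> \<open>For a cut arc from \<open>u\<close> to \<open>v\<close>, \<open>h u\<close> is
      a low edge, whereas the edge \<open>{u, v}\<close> is high because every edge at
      \<open>v\<close> is; they meet in \<open>u\<close>. The pair determines the arc, as only one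
      orientation is upward.\<close>
    show "inj_on (\<lambda>(u, v). (h u, {u, v})) (cut_arcs G g c)"
      by (auto simp: inj_on_def cut_arcs_def doubleton_eq_iff)
    show "(\<lambda>(u, v). (h u, {u, v})) ` cut_arcs G g c \<subseteq> cut_arcs (line_graph G) f c"
    proof clarify
      fix u v assume "(u, v) \<in> cut_arcs G g c"
      then have uv: "(u, v) \<in> parcs G" "g u \<le> c" "c < g v"
        by (auto simp: cut_arcs_def)
      have 1: "inc u (h u)" "f (h u) \<le> c" using h[OF incI(1)[OF uv(1)]] uv by auto
      have 2: "c < f {u, v}" using g_le[OF incI(2)[OF uv(1)]] uv by simp
      have "h u \<noteq> {u, v}" using 1 2 by auto
      then show "(h u, {u, v}) \<in> cut_arcs (line_graph G) f c"
        using 1 2 incI[OF uv(1)] by (auto simp: cut_arcs_def parcs_line_graph inc_def)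
    qed
    show "finite (cut_arcs (line_graph G) f c)" using L by (rule finite_cut_arcs)
  qed
  then have "card (cut_arcs G g c) \<le> d" for c
    using cut le_trans by blast
  moreover have "card {v \<in> pverts G. 3 \<le> card (parcs G `` {v}) \<and> g v = c} \<le> 2 * m" for c
  proof -
    define F where "F = {e \<in> pverts (line_graph G). branching (line_graph G) e \<and> f e = c}"
    have finF: "finite F" using pair_graphD(1)[OF L] by (simp add: F_def)
    have card_e: "card e \<le> 2 \<and> finite e" if "e \<in> F" for e
      using that by (auto simp: F_def pverts_line_graph card_insert_if)
    \<comment> \<open>The edge \<open>h v\<close> realises the value of \<open>v\<close> and forms a
      triangle with two further edges at \<open>v\<close>, so it is branching.\<close>
    have "{v \<in> pverts G. 3 \<le> card (parcs G `` {v}) \<and> g v = c} \<subseteq> \<Union>F"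
    proof clarify
      fix v assume v: "v \<in> pverts G" "3 \<le> card (parcs G `` {v})" "c = g v"
      then have "parcs G `` {v} \<noteq> {}" by force
      then obtain a where a: "(v, a) \<in> parcs G" by auto
      note hv = h[OF incI(1)[OF a]]
      obtain x where x: "h v = {v, x}" "(v, x) \<in> parcs G"
      proof -
        obtain a b where ab: "h v = {a, b}" "(a, b) \<in> parcs G" "v \<in> h v"
          using hv(1) by (auto simp: inc_def pverts_line_graph)
        then consider "v = a" | "v = b" by auto
        then show thesis
        proof cases
          case 1
          then show thesis using ab that[of b] by simp
        next
          case 2
          then show thesis using ab that[of a] pair_graphD(6)[OF G, of a b] by (simp add: insert_commute)
        qed
      qed
      have "\<not> parcs G `` {v} \<subseteq> {x}" using v(2) card_mono[of "{x}" "parcs G `` {v}"] by auto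
      then obtain y where y: "(v, y) \<in> parcs G" "y \<noteq> x" by auto
      have "\<not> parcs G `` {v} \<subseteq> {x, y}" using v(2) card_mono[of "{x, y}" "parcs G `` {v}"] y(2) by auto
      then obtain z where z: "(v, z) \<in> parcs G" "z \<noteq> x" "z \<noteq> y" by auto
      have "v \<noteq> x" "v \<noteq> y" "v \<noteq> z" using x y z pair_graphD(7)[OF G] by auto
      then have "({v, x}, {v, y}) \<in> parcs (line_graph G)" "({v, x}, {v, z}) \<in> parcs (line_graph G)"
          "({v, y}, {v, z}) \<in> parcs (line_graph G)"
        using x y z by (auto simp: parcs_line_graph pverts_line_graph doubleton_eq_iff)
      then have "branching (line_graph G) (h v)" unfolding branching_def x(1) by blast
      then have "h v \<in> F" using hv v(3) by (simp add: F_def inc_def)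
      then show "v \<in> \<Union>F" using x by auto
    qed
    then have "card {v \<in> pverts G. 3 \<le> card (parcs G `` {v}) \<and> g v = c} \<le> card (\<Union>F)"
      using finF card_e by (intro card_mono finite_Union) auto
    also have "\<dots> \<le> (\<Sum>e\<in>F. card e)"
      using card_e by (intro card_Union_le_sum_card) 
    also have "\<dots> \<le> of_nat (card F) * 2"
      using card_e by (intro sum_bounded_above) auto
    also have "\<dots> \<le> 2 * m" using fibre[of c] by (simp add: F_def)
    finally show ?thesis .
  qed
  ultimately show thesis by (rule that)
qed

section \<open>Walls\<close>

lemma parcs_wall_sym: "(x, y) \<in> parcs (wall t) \<Longrightarrow> (y, x) \<in> parcs (wall t)"
  by (rule pair_graphD(6)[OF pair_graph_wall])

lemma card_neighbours_wall: "card (parcs (wall t) `` {v}) \<le> 3"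
proof -
  obtain i j where v: "v = (i, j)" by (cases v)
  \<comment> \<open>The first and last rows keep every other column, so horizontal neighbours are
    two apart there. The parity of \<open>i + j\<close> decides whether the vertical edge leads to
    row \<open>i + 1\<close> or \<open>i - 1\<close>.\<close>
  define d :: nat where "d = (if i = 1 \<or> i = t then 2 else 1)"
  have "parcs (wall t) `` {v} \<subseteq> {(i, j + d), (i, j - d), (if even (i + j) then i + 1 else i - 1, j)}" (is "_ \<subseteq> ?N")
  proof
    fix y assume "y \<in> parcs (wall t) `` {v}"
    then consider "y = (i, j + d)" | "y = (i + 1, j)" "even (i + j)"
      | j' where "y = (i, j')" "j = j' + d" | i' where "y = (i', j)" "i = i' + 1" "even (i' + j)"
      by (auto simp: d_def wall_def symcl_def v)
    then show "y \<in> ?N" by cases auto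
  qed
  then have "card (parcs (wall t) `` {v}) \<le> card ?N"
    by (intro card_mono) auto
  also have "\<dots> \<le> 3" by (simp add: card_insert_if)
  finally show ?thesis .
qed

lemma wall_row_arc:
  assumes "2 \<le> i" "i < t" "1 \<le> j" "j < 2 * t"
  shows "((i, j), (i, j + 1)) \<in> parcs (wall t)"
  using assms by (auto simp: wall_def symcl_def wall_verts_def)

lemma wall_column_arc:
  assumes "2 \<le> i" "i + 1 < t" "1 \<le> j" "j \<le> 2 * t" "even (i + j)"
  shows "((i, j), (i + 1, j)) \<in> parcs (wall t)"
  using assms by (auto simp: wall_def symcl_def wall_verts_def)

text \<open>Column 2 is interior to a full row, and the range of \<open>i\<close> puts the vertical
  neighbour into a full row as well.\<close>

lemma wall_branch_vertex:
  assumes "3 \<le> i" "i + 2 \<le> t"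
  shows "(i, 2) \<in> pverts (wall t)" "3 \<le> card (parcs (wall t) `` {(i, 2)})"
proof -
  show "(i, 2) \<in> pverts (wall t)"
    using assms by (auto simp: wall_def wall_verts_def)
  define k where "k = (if even i then i + 1 else i - 1)"
  have "((i, 1), (i, 1 + 1)) \<in> parcs (wall t)" "((i, 2), (i, 2 + 1)) \<in> parcs (wall t)"
    using assms by (intro wall_row_arc; simp)+
  moreover have "((i, 2), (k, 2)) \<in> parcs (wall t)"
  proof (cases "even i")
    case True
    then show ?thesis using wall_column_arc[of i t 2] assms by (simp add: k_def)
  next
    case False
    then show ?thesis using wall_column_arc[of "i - 1" t 2] assms
      by (auto simp: k_def intro: parcs_wall_sym)
  qed
  ultimately have "{(i, 1), (i, 3), (k, 2)} \<subseteq> parcs (wall t) `` {(i, 2)}"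
    using parcs_wall_sym by (auto simp: numeral_3_eq_3 numeral_2_eq_2)
  then have "card {(i, 1::nat), (i, 3), (k, 2)} \<le> card (parcs (wall t) `` {(i, 2)})"
    by (intro card_mono pair_graphD(3)[OF pair_graph_wall])
  then show "3 \<le> card (parcs (wall t) `` {(i, 2)})" by (simp add: card_insert_if)
qed

text \<open>Read contrapositively: a row with vertices on both sides contains a cut arc.\<close>

lemma uncut_row_one_sided:
  assumes "2 \<le> i" "i < t" "1 \<le> j" "j \<le> 2 * t"
    and "\<And>j j'. ((i, j), (i, j')) \<notin> cut_arcs (wall t) f c"
  shows "f (i, j) \<le> c \<longleftrightarrow> f (i, 1) \<le> c"
  using assms(3,4)
proof (induction j rule: nat_induct_at_least)
  case base
  show ?case by simp
next
  case (Suc j)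
  have "((i, j), (i, Suc j)) \<in> parcs (wall t)" "((i, Suc j), (i, j)) \<in> parcs (wall t)"
    using wall_row_arc[of i t j] parcs_wall_sym assms Suc by auto
  then have "f (i, Suc j) \<le> c \<longleftrightarrow> f (i, j) \<le> c"
    using assms(5)[of j "Suc j"] assms(5)[of "Suc j" j] by (auto simp: cut_arcs_def)
  then show ?case using Suc by simp
qed

text \<open>The \<open>q\<close>-th column path runs through the columns \<open>2q - 1\<close> and \<open>2q\<close> of the wall.\<close>

lemma uncut_column_one_sided:
  assumes "2 \<le> i" "i < t" "1 \<le> q" "q \<le> t"
    and "\<And>i i' j j'. j \<in> {2 * q - 1, 2 * q} \<Longrightarrow> j' \<in> {2 * q - 1, 2 * q} \<Longrightarrow>
           ((i, j), (i', j')) \<notin> cut_arcs (wall t) f c"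
  shows "f (i, 2 * q) \<le> c \<longleftrightarrow> f (2, 2 * q) \<le> c"
proof -
  have arc: "f x \<le> c \<longleftrightarrow> f y \<le> c"
    if "(x, y) \<in> parcs (wall t)" "snd x \<in> {2 * q - 1, 2 * q}" "snd y \<in> {2 * q - 1, 2 * q}" for x y
    using that parcs_wall_sym[OF that(1)] assms(5)[of "snd x" "snd y" "fst x" "fst y"]
      assms(5)[of "snd y" "snd x" "fst y" "fst x"]
    by (auto simp: cut_arcs_def)
  have row: "f (i, 2 * q - 1) \<le> c \<longleftrightarrow> f (i, 2 * q) \<le> c" if "2 \<le> i" "i < t" for i
    using wall_row_arc[of i t "2 * q - 1"] that assms by (intro arc) auto
  show ?thesis using assms(1,2)
  proof (induction i rule: nat_induct_at_least)
    case base
    show ?case by simp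
  next
    case (Suc i)
    \<comment> \<open>Of the two columns, the one with the parity of \<open>i\<close> carries the
      edge to row \<open>i + 1\<close>; row edges switch between the two.\<close>
    define j where "j = (if even i then 2 * q else 2 * q - 1)"
    have "((i, j), (i + 1, j)) \<in> parcs (wall t)"
      using Suc assms by (intro wall_column_arc) (auto simp: j_def)
    then have "f (i, j) \<le> c \<longleftrightarrow> f (i + 1, j) \<le> c"
      by (intro arc) (auto simp: j_def)
    then have "f (Suc i, 2 * q) \<le> c \<longleftrightarrow> f (i, 2 * q) \<le> c"
      using row[of i] row[of "Suc i"] Suc by (auto simp: j_def split: if_splits)
    then show ?case using Suc by simp
  qed
qed

text \<open>Pigeonhole: \<open>h\<close> assigns an element of \<open>X\<close> to one class only,
  so distinct classes have distinct witnesses.\<close>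

lemma card_classes_met_le:
  assumes "finite X" "\<And>i. i \<in> I \<Longrightarrow> \<exists>x\<in>X. h x = i"
  shows "card I \<le> card X"
proof -
  have "I \<subseteq> h ` X" using assms(2) by blast
  then show ?thesis using assms(1) surj_card_le by blast
qed

text \<open>
  At every threshold some row lies on one side, and rows cannot lie on both sides because then every
  column would be cut. So the side switches at a single threshold, where most rows lie in one fibre.
\<close>

lemma wall_layout_fibre:
  assumes cut: "\<And>c. card (cut_arcs (wall t) f c) \<le> d" and t: "2 * d + 4 < t"
  obtains c where "t - 4 - 2 * d \<le> card {v \<in> pverts (wall t). 3 \<le> card (parcs (wall t) `` {v}) \<and> f v = c}"
proof -
  \<comment> \<open>The rows whose vertex in column 2 is a branch vertex by
    \<open>wall_branch_vertex\<close>.\<close>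
  define I where "I = {3..t - 2}"
  define low where "low c = {i \<in> I. \<forall>j. 1 \<le> j \<longrightarrow> j \<le> 2 * t \<longrightarrow> f (i, j) \<le> c}" for c
  define high where "high c = {i \<in> I. \<forall>j. 1 \<le> j \<longrightarrow> j \<le> 2 * t \<longrightarrow> c < f (i, j)}" for c
  have cardI: "card I = t - 4" and finI: "finite I" using t by (auto simp: I_def)
  have fin: "finite (low c)" "finite (high c)" for c using finI by (auto simp: low_def high_def)
  \<comment> \<open>A row that is neither low nor high contains a cut arc; arcs are attributed to
    the row of their tail.\<close>
  have mixed: "card (I - (low c \<union> high c)) \<le> d" for c
  proof -
    have "card (I - (low c \<union> high c)) \<le> card (cut_arcs (wall t) f c)"
    proof (rule card_classes_met_le[where h = "fst \<circ> fst"])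
      fix i assume i: "i \<in> I - (low c \<union> high c)"
      show "\<exists>x\<in>cut_arcs (wall t) f c. (fst \<circ> fst) x = i"
      proof (rule ccontr)
        assume "\<not> (\<exists>x\<in>cut_arcs (wall t) f c. (fst \<circ> fst) x = i)"
        then have no: "((i, j), (i, j')) \<notin> cut_arcs (wall t) f c" for j j'
          by fastforce
        have side: "f (i, j) \<le> c \<longleftrightarrow> f (i, 1) \<le> c" if "1 \<le> j" "j \<le> 2 * t" for j
          using i t that no by (intro uncut_row_one_sided[of i t]) (auto simp: I_def)
        have "i \<in> low c \<union> high c"
        proof (cases "f (i, 1) \<le> c")
          case True
          then have "i \<in> low c" unfolding low_def using i side by blast
          then show ?thesis by blast
        next
          case False
          then have "i \<in> high c" unfolding high_def using i side not_le by blast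
          then show ?thesis by blast
        qed
        then show False using i by blast
      qed
    qed (simp add: finite_cut_arcs pair_graph_wall)
    then show ?thesis using cut le_trans by blast
  qed
  have not_both: "low c = {} \<or> high c = {}" for c
  proof (rule ccontr)
    assume "\<not> (low c = {} \<or> high c = {})"
    then obtain i i' where ii': "i \<in> low c" "i' \<in> high c" by blast
    \<comment> \<open>Each of the \<open>t\<close> column paths meets both the low and the high row,
      so it contains a cut arc. The map sends columns \<open>2 * q - 1\<close> and
      \<open>2 * q\<close> to \<open>q\<close>.\<close>
    have "card {1..t} \<le> card (cut_arcs (wall t) f c)"
    proof (rule card_classes_met_le[where h = "\<lambda>x. (snd (fst x) + 1) div 2"])
      fix q assume q: "q \<in> {1..t}"
      show "\<exists>x\<in>cut_arcs (wall t) f c. (snd (fst x) + 1) div 2 = q"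
      proof (rule ccontr)
        assume neg: "\<not> (\<exists>x\<in>cut_arcs (wall t) f c. (snd (fst x) + 1) div 2 = q)"
        have no: "((a, j), (b, j')) \<notin> cut_arcs (wall t) f c" if "j \<in> {2 * q - 1, 2 * q}" for a b j j'
        proof
          assume "((a, j), (b, j')) \<in> cut_arcs (wall t) f c"
          then have "(j + 1) div 2 \<noteq> q" using neg by fastforce
          then show False using that q by auto
        qed
        have side: "f (k, 2 * q) \<le> c \<longleftrightarrow> f (2, 2 * q) \<le> c" if "k \<in> I" for k
          using that q t no by (intro uncut_column_one_sided[of k t q]) (auto simp: I_def)
        have "i \<in> I" "i' \<in> I" "f (i, 2 * q) \<le> c" "\<not> f (i', 2 * q) \<le> c"
          using ii' q by (auto simp: low_def high_def not_le)
        then show False using side by blast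
      qed
    qed (simp add: finite_cut_arcs pair_graph_wall)
    then show False using cut[of c] t by simp
  qed
  have large: "t - 4 - d \<le> card (low c)" if "high c = {}" for c
    using mixed[of c] that cardI fin[of c] card_Diff_subset[of "low c" I] by (auto simp: low_def)
  have large': "t - 4 - d \<le> card (high c)" if "low c = {}" for c
    using mixed[of c] that cardI fin[of c] card_Diff_subset[of "high c" I] by (auto simp: high_def)
  \<comment> \<open>An upper bound of all values on these rows, so a threshold with low rows exists,
    and hence a least one.\<close>
  define N where "N = Max (f ` (I \<times> {1..2 * t}))"
  have "low N = I"
    using finI by (auto simp: low_def N_def)
  then have exN: "low N \<noteq> {}" using cardI t by force
  define c where "c = (LEAST c. low c \<noteq> {})"
  have lowc: "low c \<noteq> {}" unfolding c_def using exN by (rule LeastI)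
  \<comment> \<open>The rows on which \<open>f\<close> is constantly \<open>c\<close>.\<close>
  define R where "R = {i \<in> low c. \<forall>j. 1 \<le> j \<longrightarrow> j \<le> 2 * t \<longrightarrow> c \<le> f (i, j)}"
  have R: "t - 4 - 2 * d \<le> card R"
  proof (cases c)
    case 0
    then have "R = low c" by (auto simp: R_def)
    then show ?thesis using large[of c] not_both[of c] lowc by simp
  next
    case (Suc c')
    \<comment> \<open>One below the least threshold no row is low, so all but \<open>d\<close> rows
      are high there; all but \<open>d\<close> rows are low at \<open>c\<close>. The overlap of the
      two families is \<open>R\<close>.\<close>
    have "low c' = {}" using not_less_Least[of c' "\<lambda>c. low c \<noteq> {}"] Suc by (auto simp: c_def)
    then have h: "t - 4 - d \<le> card (high c')" by (rule large')
    have l: "t - 4 - d \<le> card (low c)" using large[of c] not_both[of c] lowc by simp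
    have "low c \<inter> high c' = R" using Suc by (auto simp: R_def high_def low_def Suc_le_eq)
    moreover have "card (low c \<union> high c') \<le> card I"
      using finI by (intro card_mono) (auto simp: low_def high_def)
    ultimately show ?thesis
      using h l cardI card_Un_Int[OF fin(1)[of c] fin(2)[of c']] t by simp
  qed
  also have "card R = card ((\<lambda>i. (i, 2::nat)) ` R)"
    by (intro card_image[symmetric]) (auto simp: inj_on_def)
  also have "\<dots> \<le> card {v \<in> pverts (wall t). 3 \<le> card (parcs (wall t) `` {v}) \<and> f v = c}"
  proof (rule card_mono)
    show "finite {v \<in> pverts (wall t). 3 \<le> card (parcs (wall t) `` {v}) \<and> f v = c}"
      using pair_graphD(1)[OF pair_graph_wall] by simp
    have "f (i, 2) = c" if "i \<in> R" for i
    proof (rule antisym)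
      show "f (i, 2) \<le> c" "c \<le> f (i, 2)"
        using that t unfolding R_def low_def by force+
    qed
    moreover have "3 \<le> i \<and> i + 2 \<le> t" if "i \<in> R" for i
      using that t by (auto simp: R_def low_def I_def)
    ultimately show "(\<lambda>i. (i, 2)) ` R \<subseteq> {v \<in> pverts (wall t). 3 \<le> card (parcs (wall t) `` {v}) \<and> f v = c}"
      using wall_branch_vertex by blast
  qed
  finally show thesis by (rule that)
qed

section \<open>Star-path graphs are clean\<close>

text \<open>
  The pair \<open>(0, i)\<close> is the \<open>i\<close>-th star centre, and \<open>(j, p)\<close> with \<open>0 < j\<close> is the vertex at position \<open>p\<close>
  of the \<open>j\<close>-th path. A centre sees one vertex of each path, or two consecutive ones if \<open>b\<close> holds.
\<close>

definition star_path_step :: "bool \<Rightarrow> nat \<Rightarrow> nat \<times> nat \<Rightarrow> nat \<times> nat \<Rightarrow> bool" where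
  "star_path_step b k x y \<longleftrightarrow>
     fst x = 0 \<and> 0 < fst y \<and> (snd y = k * snd x \<or> b \<and> snd y = k * snd x + 1) \<or>
     0 < fst x \<and> fst y = fst x \<and> snd y = snd x + 1"

definition star_path_adj :: "bool \<Rightarrow> nat \<Rightarrow> nat \<times> nat \<Rightarrow> nat \<times> nat \<Rightarrow> bool" where
  "star_path_adj b k x y \<longleftrightarrow> star_path_step b k x y \<or> star_path_step b k y x"

text \<open>A centre sits at the position of its first attachment, so adjacent vertices differ in
  position by at most one.\<close>

definition star_path_pos :: "nat \<Rightarrow> nat \<times> nat \<Rightarrow> nat" where
  "star_path_pos k x = (if fst x = 0 then k * snd x else snd x)"

section \<open>Neighbours and positions in star-path graphs\<close>

lemma star_path_adj_sym: "star_path_adj b k x y \<longleftrightarrow> star_path_adj b k y x"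
  by (auto simp: star_path_adj_def)

lemma star_path_adj_irrefl: "\<not> star_path_adj b k x x"
  by (auto simp: star_path_adj_def star_path_step_def)

lemma star_path_adj_centre:
  "star_path_adj b k (0, i) y \<longleftrightarrow> 0 < fst y \<and> (snd y = k * i \<or> b \<and> snd y = k * i + 1)"
  by (auto simp: star_path_adj_def star_path_step_def)

lemma star_path_adj_path:
  "0 < j \<Longrightarrow> 0 < fst y \<Longrightarrow>
     star_path_adj b k (j, p) y \<longleftrightarrow> fst y = j \<and> (snd y = Suc p \<or> p = Suc (snd y))"
  by (auto simp: star_path_adj_def star_path_step_def)

lemma star_path_pos_adj:
  "star_path_adj b k x y \<Longrightarrow> star_path_pos k y \<le> Suc (star_path_pos k x)"
  by (auto simp: star_path_adj_def star_path_step_def star_path_pos_def)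

text \<open>A first attachment position is never a second one; hence a path vertex is attached to at
  most one centre.\<close>

lemma mult_neq_Suc_mult:
  fixes k :: nat
  assumes "2 \<le> k"
  shows "k * i \<noteq> Suc (k * i')"
proof
  assume "k * i = Suc (k * i')"
  then have "k * i mod k = Suc (k * i') mod k" by simp
  then show False using assms by (simp add: mod_Suc)
qed

text \<open>
  The layout counts the centres of the embedded graph up to the position of a vertex. It increases
  only along path edges entering the neighbourhood of a centre, and such a centre has bounded degree.
\<close>

lemma star_path_layout:
  assumes S: "pair_graph S" and k: "2 \<le> k"
    and inj: "inj_on \<phi> (pverts S)"
    and emb: "\<And>u v. u \<in> pverts S \<Longrightarrow> v \<in> pverts S \<Longrightarrow>
                (u, v) \<in> parcs S \<longleftrightarrow> star_path_adj b k (\<phi> u) (\<phi> v)"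
    and deg: "\<And>v. v \<in> pverts S \<Longrightarrow> card (parcs S `` {v}) \<le> d"
  obtains f where "\<And>c. card (cut_arcs S f c) \<le> d"
    and "\<And>c. card {v \<in> pverts S. branching S v \<and> f v = c} \<le> Suc d"
proof -
  define I where "I = {i. (0, i) \<in> \<phi> ` pverts S}"
  have "I \<subseteq> snd ` \<phi> ` pverts S"
    unfolding I_def by (metis (mono_tags) imageI mem_Collect_eq snd_conv subsetI)
  then have finI: "finite I" using pair_graphD(1)[OF S] finite_surj by blast
  \<comment> \<open>\<open>F\<close> jumps exactly at the positions \<open>k * i\<close> of the
    centres that the embedding uses.\<close>
  define F where "F q = card {i \<in> I. k * i \<le> q}" for q
  define f where "f v = F (star_path_pos k (\<phi> v))" for v
  have F_mono: "F q \<le> F q'" if "q \<le> q'" for q q'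
    unfolding F_def using finI that by (intro card_mono) auto
  have F_strict: "F q < F q'" if "i \<in> I" "q < k * i" "k * i \<le> q'" for q q' i
  proof -
    have "{i \<in> I. k * i \<le> q} \<subset> {i \<in> I. k * i \<le> q'}"
    proof (rule psubsetI)
      show "{i \<in> I. k * i \<le> q} \<subseteq> {i \<in> I. k * i \<le> q'}" using that by auto
      show "{i \<in> I. k * i \<le> q} \<noteq> {i \<in> I. k * i \<le> q'}" using that not_le by blast
    qed
    then show ?thesis unfolding F_def using finI by (intro psubset_card_mono) auto
  qed
  have F_eq: "F (Suc q) = F q" if "\<And>i. i \<in> I \<Longrightarrow> k * i \<noteq> Suc q" for q
    unfolding F_def using that by (intro arg_cong[where f = card]) (auto simp: le_Suc_eq)
  have arcD: "u \<in> pverts S" "v \<in> pverts S" "star_path_adj b k (\<phi> u) (\<phi> v)" if "(u, v) \<in> parcs S" for u v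
    using that emb pair_graphD(4,5)[OF S that] by auto
  have centre: "\<exists>s\<in>pverts S. \<phi> s = (0, i)" if "i \<in> I" for i
    using that by (force simp: I_def)

  \<comment> \<open>A rise of \<open>f\<close> means that the position grows by one and reaches some
    \<open>k * i\<close>. An arc at a centre cannot do this: its other end has the same position or
    the next one, which is no multiple of \<open>k\<close>.\<close>
  have entering: "\<exists>i j p. i \<in> I \<and> 0 < j \<and> \<phi> v = (j, k * i) \<and> \<phi> u = (j, p) \<and> Suc p = k * i"
    if uv: "(u, v) \<in> cut_arcs S f c" for u v c
  proof -
    have adj: "star_path_adj b k (\<phi> u) (\<phi> v)" and less: "f u < f v"
      using uv arcD by (auto simp: cut_arcs_def)
    have step: "star_path_pos k (\<phi> v) = Suc (star_path_pos k (\<phi> u))"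
      using F_mono[of "star_path_pos k (\<phi> v)" "star_path_pos k (\<phi> u)"] less star_path_pos_adj[OF adj]
      by (fastforce simp: f_def)
    then obtain i where i: "i \<in> I" "star_path_pos k (\<phi> v) = k * i"
      using F_eq[of "star_path_pos k (\<phi> u)"] less unfolding f_def by fastforce
    show ?thesis
      using adj step i mult_neq_Suc_mult[OF k]
      by (cases "\<phi> u"; cases "\<phi> v")
         (auto simp: star_path_adj_def star_path_step_def star_path_pos_def split: if_splits)
  qed

  have "card (cut_arcs S f c) \<le> d" for c
  proof (cases "cut_arcs S f c = {}")
    case False
    then obtain u0 v0 where uv0: "(u0, v0) \<in> cut_arcs S f c" by auto
    obtain i j0 p0 where i: "i \<in> I" "0 < j0" "\<phi> v0 = (j0, k * i)" "\<phi> u0 = (j0, p0)" "Suc p0 = k * i"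
      using entering[OF uv0] by blast
    obtain s where s: "s \<in> pverts S" "\<phi> s = (0, i)" using centre[OF i(1)] by blast
    \<comment> \<open>All cut arcs jump over the same \<open>c\<close>, so monotonicity of
      \<open>F\<close> puts the jumps at one position. Their heads are then distinct neighbours of
      the single centre \<open>s\<close>.\<close>
    have same: "\<exists>j p. 0 < j \<and> \<phi> v = (j, k * i) \<and> \<phi> u = (j, p) \<and> Suc p = k * i"
      if uv: "(u, v) \<in> cut_arcs S f c" for u v
    proof -
      obtain i' j p where i': "i' \<in> I" "0 < j" "\<phi> v = (j, k * i')" "\<phi> u = (j, p)" "Suc p = k * i'"
        using entering[OF uv] by blast
      have val: "f u = F p" "f v = F (k * i')" "f u0 = F p0" "f v0 = F (k * i)"
        using i i' by (simp_all add: f_def star_path_pos_def)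
      have c: "F p \<le> c" "c < F (k * i')" "F p0 \<le> c" "c < F (k * i)"
        using uv uv0 val by (auto simp: cut_arcs_def)
      have "\<not> k * i \<le> p" using c F_mono[of "k * i" p] by auto
      moreover have "\<not> k * i' \<le> p0" using c F_mono[of "k * i'" p0] by auto
      ultimately have "k * i = k * i'" using i i' by linarith
      then show ?thesis using i' by auto
    qed
    have "inj_on snd (cut_arcs S f c)"
    proof (rule inj_onI)
      fix x y
      assume xy: "x \<in> cut_arcs S f c" "y \<in> cut_arcs S f c" "snd x = snd y"
      obtain u u' v where uv: "x = (u, v)" "y = (u', v)" using xy(3) by (cases x, cases y) auto
      have "\<phi> u = \<phi> u'" using same[of u v] same[of u' v] xy uv by auto
      moreover have "u \<in> pverts S" "u' \<in> pverts S" using xy uv arcD by (auto simp: cut_arcs_def)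
      ultimately show "x = y" using inj uv by (auto dest: inj_onD)
    qed
    moreover have "snd ` cut_arcs S f c \<subseteq> parcs S `` {s}"
    proof (rule image_subsetI)
      fix x assume x: "x \<in> cut_arcs S f c"
      obtain u v where xuv: "x = (u, v)" by (cases x)
      have uv: "(u, v) \<in> cut_arcs S f c" using x xuv by simp
      then have v: "v \<in> pverts S" using arcD by (auto simp: cut_arcs_def)
      have "star_path_adj b k (\<phi> s) (\<phi> v)"
        using same[OF uv] s by (auto simp: star_path_adj_centre)
      then show "snd x \<in> parcs S `` {s}" using emb[OF s(1) v] xuv by simp
    qed
    ultimately have "card (cut_arcs S f c) \<le> card (parcs S `` {s})"
      using pair_graphD(3)[OF S] by (rule card_inj_on_le)
    then show ?thesis using deg[OF s(1)] by simp
  qed simp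

  moreover have "card {v \<in> pverts S. branching S v \<and> f v = c} \<le> Suc d" for c
  proof -
    define B where "B = {v \<in> pverts S. branching S v \<and> f v = c}"
    \<comment> \<open>A vertex without such a centre has at most its two path neighbours, and these
      are not adjacent, so it cannot be branching.\<close>
    have near: "\<exists>s\<in>pverts S. fst (\<phi> s) = 0 \<and> f s = f v \<and> (v = s \<or> (s, v) \<in> parcs S)"
      if v: "v \<in> pverts S" "branching S v" for v
    proof (rule ccontr)
      assume neg: "\<not> ?thesis"
      obtain j p where jp: "\<phi> v = (j, p)" by (cases "\<phi> v")
      have j: "0 < j" using neg v jp by auto
      have nb: "\<phi> x = (j, Suc p) \<or> \<phi> x = (j, p - 1) \<and> 0 < p" if x: "(v, x) \<in> parcs S" for x
      proof -
        obtain a q where aq: "\<phi> x = (a, q)" by (cases "\<phi> x")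
        note vx = arcD[OF x]
        have xv: "(x, v) \<in> parcs S" using pair_graphD(6)[OF S x] .
        have "a \<noteq> 0"
        proof
          assume a: "a = 0"
          then have pq: "p = k * q \<or> p = Suc (k * q)"
            using vx(3) jp aq star_path_adj_sym star_path_adj_centre by fastforce
          \<comment> \<open>The second attachment position shares the layout value of its centre,
            since no centre sits there.\<close>
          have "F (Suc (k * q)) = F (k * q)"
            by (intro F_eq mult_neq_Suc_mult k)
          then have "f x = f v" using pq jp aq a j by (auto simp: f_def star_path_pos_def)
          then show False using neg xv aq a vx(2) by auto
        qed
        then show ?thesis using vx(3) j by (auto simp: jp aq star_path_adj_path)
      qed
      have "\<phi> ` (parcs S `` {v}) \<subseteq> {(j, Suc p), (j, p - 1)}" using nb by (intro image_subsetI) blast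
      then have "card (\<phi> ` (parcs S `` {v})) \<le> card {(j, Suc p), (j, p - 1)}"
        by (intro card_mono) auto
      also have "\<dots> \<le> 2" by (simp add: card_insert_if)
      finally have "card (\<phi> ` (parcs S `` {v})) \<le> 2" .
      moreover have "inj_on \<phi> (parcs S `` {v})"
        using inj by (rule inj_on_subset) (use arcD in auto)
      ultimately have "card (parcs S `` {v}) \<le> 2" by (simp add: card_image)
      then obtain x y where xy: "(v, x) \<in> parcs S" "(v, y) \<in> parcs S" "(x, y) \<in> parcs S"
        using v(2) by (auto simp: branching_def)
      show False
        using nb[OF xy(1)] nb[OF xy(2)] arcD(3)[OF xy(3)] j by (auto simp: star_path_adj_path)
    qed
    have "card B \<le> Suc d"
    proof (cases "B = {}")
      case False
      then obtain v0 where "v0 \<in> B" by blast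
      then obtain s where s: "s \<in> pverts S" "fst (\<phi> s) = 0" "f s = c"
        using near by (force simp: B_def)
      obtain i where i: "\<phi> s = (0, i)" using s(2) by (cases "\<phi> s") auto
      have iI: "i \<in> I" using i s(1) by (force simp: I_def)
      \<comment> \<open>\<open>F\<close> rises strictly at every used centre, so a fibre contains at
        most one of them.\<close>
      have uniq: "s' = s" if s': "s' \<in> pverts S" "fst (\<phi> s') = 0" "f s' = c" for s'
      proof -
        obtain i' where i': "\<phi> s' = (0, i')" using s'(2) by (cases "\<phi> s'") auto
        have i'I: "i' \<in> I" using i' s'(1) by (force simp: I_def)
        have "F (k * i) = F (k * i')" using s s' i i' by (simp add: f_def star_path_pos_def)
        then have "\<not> k * i < k * i'" "\<not> k * i' < k * i"
          using F_strict[OF iI, of "k * i'" "k * i"] F_strict[OF i'I, of "k * i" "k * i'"] by auto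
        then have "i = i'" using k by simp
        then show ?thesis using i i' s(1) s'(1) inj_onD[OF inj, of s' s] by simp
      qed
      have "B \<subseteq> insert s (parcs S `` {s})"
      proof
        fix v assume "v \<in> B"
        then have "v \<in> pverts S" "branching S v" "f v = c" by (auto simp: B_def)
        then obtain s' where "s' \<in> pverts S" "fst (\<phi> s') = 0" "f s' = c" "v = s' \<or> (s', v) \<in> parcs S"
          using near by fastforce
        then show "v \<in> insert s (parcs S `` {s})" using uniq by blast
      qed
      then have "card B \<le> card (insert s (parcs S `` {s}))"
        using pair_graphD(3)[OF S] by (intro card_mono) auto
      also have "\<dots> \<le> Suc (card (parcs S `` {s}))" by (rule card_insert_le_m1) auto
      finally show ?thesis using deg[OF s(1)] by simp
    qed simp
    then show ?thesis by (simp add: B_def)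
  qed
  ultimately show thesis by (rule that)
qed

section \<open>Finite star-path graphs and their induced subgraphs\<close>

definition star_path_verts :: "nat \<Rightarrow> nat \<Rightarrow> (nat \<times> nat) set" where
  "star_path_verts k n = {0} \<times> {..<n} \<union> {1..n} \<times> {..<k * n + 2}"

text \<open>Pairs are encoded because graph classes live on natural numbers. Paths are numbered from
  1, as 0 marks centres, and \<open>k * n + 2\<close> positions hold both attachments of every
  centre.\<close>

definition star_path_graph :: "bool \<Rightarrow> nat \<Rightarrow> nat \<Rightarrow> nat pair_pre_digraph" where
  "star_path_graph b k n =
     \<lparr> pverts = prod_encode ` star_path_verts k n,
       parcs = {(u, v). u \<in> prod_encode ` star_path_verts k n \<and> v \<in> prod_encode ` star_path_verts k n \<and>
         star_path_adj b k (prod_decode u) (prod_decode v)} \<rparr>"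

lemma pair_graph_star_path_graph: "pair_graph (star_path_graph b k n)"
proof -
  have "finite (star_path_verts k n)" by (simp add: star_path_verts_def)
  then have fin: "finite (pverts (star_path_graph b k n))" by (simp add: star_path_graph_def)
  moreover have "finite (parcs (star_path_graph b k n))"
    by (rule finite_subset[of _ "pverts (star_path_graph b k n) \<times> pverts (star_path_graph b k n)"])
       (auto simp: fin, auto simp: star_path_graph_def)
  ultimately show ?thesis
    by unfold_locales
       (auto simp: star_path_graph_def symmetric_def sym_def star_path_adj_irrefl star_path_adj_sym)
qed

text \<open>Reduces an isomorphism, which also maps arcs, to its vertex map: an induced subgraph
  inherits \<open>fst\<close> and \<open>snd\<close> as tail and head, so an arc is determined by
  the images of its ends.\<close>

lemma induced_subgraph_embedding:
  assumes B: "induced_subgraph B (with_proj G)" and iso: "digraph_iso (with_proj S) B"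
  obtains \<phi> where "inj_on \<phi> (pverts S)" "\<phi> ` pverts S = verts B"
    and "\<And>u v. u \<in> pverts S \<Longrightarrow> v \<in> pverts S \<Longrightarrow> (u, v) \<in> parcs S \<longleftrightarrow> (\<phi> u, \<phi> v) \<in> parcs G"
proof -
  obtain h where h: "pre_digraph.digraph_isomorphism (with_proj S) h" "B = app_iso h (with_proj S)"
    using iso by (auto simp: digraph_iso_def)
  define \<phi> where "\<phi> = iso_verts h"
  have wf: "fst a \<in> pverts S" "snd a \<in> pverts S" if "a \<in> parcs S" for a
    using h(1) that by (cases a, auto simp: pre_digraph.digraph_isomorphism_def wf_digraph_def)+
  have inj: "inj_on \<phi> (pverts S)"
    using h(1) by (simp add: pre_digraph.digraph_isomorphism_def \<phi>_def)
  have img: "\<phi> ` pverts S = verts B" using h(2) by (simp add: \<phi>_def)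
  have ht: "iso_tail h = fst" "iso_head h = snd"
    using B h(2) by (auto simp: induced_subgraph_def subgraph_def compatible_def)
  have arcs: "iso_arcs h a = (\<phi> (fst a), \<phi> (snd a))" if "a \<in> parcs S" for a
    using h(1) that by (auto simp: pre_digraph.digraph_isomorphism_def \<phi>_def ht prod_eq_iff)
  have arcsB: "arcs B = {e \<in> parcs G. fst e \<in> verts B \<and> snd e \<in> verts B}"
    using B by (simp add: induced_subgraph_def)
  have arcsB': "arcs B = (\<lambda>a. (\<phi> (fst a), \<phi> (snd a))) ` parcs S"
    using h(2) arcs by (auto simp: image_iff)
  have "(u, v) \<in> parcs S \<longleftrightarrow> (\<phi> u, \<phi> v) \<in> parcs G" if uv: "u \<in> pverts S" "v \<in> pverts S" for u v
  proof
    assume "(u, v) \<in> parcs S"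
    then have "(\<phi> u, \<phi> v) \<in> arcs B" unfolding arcsB' by force
    then show "(\<phi> u, \<phi> v) \<in> parcs G" unfolding arcsB by simp
  next
    assume "(\<phi> u, \<phi> v) \<in> parcs G"
    then have "(\<phi> u, \<phi> v) \<in> arcs B" unfolding arcsB using uv img by auto
    then obtain a where a: "a \<in> parcs S" "\<phi> u = \<phi> (fst a)" "\<phi> v = \<phi> (snd a)"
      unfolding arcsB' by auto
    then have "u = fst a" "v = snd a" using inj wf[OF a(1)] uv by (auto dest: inj_onD)
    then show "(u, v) \<in> parcs S" using a(1) by simp
  qed
  then show thesis using inj img by (intro that) auto
qed

lemma star_path_graph_embedding:
  assumes B: "induced_subgraph B (with_proj (star_path_graph b k n))" and iso: "digraph_iso (with_proj S) B"
  obtains \<phi> where "inj_on \<phi> (pverts S)"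
    and "\<And>u v. u \<in> pverts S \<Longrightarrow> v \<in> pverts S \<Longrightarrow> (u, v) \<in> parcs S \<longleftrightarrow> star_path_adj b k (\<phi> u) (\<phi> v)"
proof -
  obtain \<psi> where \<psi>: "inj_on \<psi> (pverts S)" "\<psi> ` pverts S = verts B"
    "\<And>u v. u \<in> pverts S \<Longrightarrow> v \<in> pverts S \<Longrightarrow> (u, v) \<in> parcs S \<longleftrightarrow> (\<psi> u, \<psi> v) \<in> parcs (star_path_graph b k n)"
    using induced_subgraph_embedding[OF B iso] by blast
  have sub: "\<psi> u \<in> prod_encode ` star_path_verts k n" if "u \<in> pverts S" for u
    using B \<psi>(2) that by (auto simp: induced_subgraph_def subgraph_def star_path_graph_def)
  show thesis
  proof (rule that)
    show "inj_on (prod_decode \<circ> \<psi>) (pverts S)"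
      using \<psi>(1) by (intro comp_inj_on) (auto intro: inj_on_subset[OF inj_prod_decode])
    show "(u, v) \<in> parcs S \<longleftrightarrow> star_path_adj b k ((prod_decode \<circ> \<psi>) u) ((prod_decode \<circ> \<psi>) v)"
      if "u \<in> pverts S" "v \<in> pverts S" for u v
      using \<psi>(3)[OF that] sub[OF that(1)] sub[OF that(2)] by (simp add: star_path_graph_def)
  qed
qed

text \<open>Centres are pairwise nonadjacent, so a clique of four has three path vertices, but three
  positions cannot pairwise differ by exactly one.\<close>

lemma no_star_path_complete:
  assumes adj: "\<And>x y. x \<in> X \<Longrightarrow> y \<in> X \<Longrightarrow> x \<noteq> y \<Longrightarrow> star_path_adj b k x y"
  shows "card X < 4"
proof (rule ccontr)
  assume "\<not> card X < 4"
  then have X: "4 \<le> card X" "finite X" by (auto intro: card_ge_0_finite)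
  define Z where "Z = {x \<in> X. fst x = 0}"
  have "x = y" if "x \<in> Z" "y \<in> Z" for x y
    using that adj[of x y] by (auto simp: Z_def star_path_adj_def star_path_step_def)
  moreover have "finite Z" using X(2) by (simp add: Z_def)
  ultimately have "card Z \<le> Suc 0" by (simp add: card_le_Suc0_iff_eq)
  moreover have "card (X - Z) = card X - card Z"
    using X(2) by (intro card_Diff_subset) (auto simp: Z_def)
  ultimately have "3 \<le> card (X - Z)" using X(1) by simp
  then obtain T where "T \<subseteq> X - Z" "card T = 3" by (meson obtain_subset_with_card_n)
  then obtain x y z where xyz: "{x, y, z} \<subseteq> X - Z" "x \<noteq> y" "y \<noteq> z" "x \<noteq> z"
    by (auto simp: card_3_iff)
  have "snd v = Suc (snd u) \<or> snd u = Suc (snd v)" if "u \<in> {x, y, z}" "v \<in> {x, y, z}" "u \<noteq> v" for u v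
    using adj[of u v] star_path_adj_path[of "fst u" v b k "snd u"] that xyz(1) by (auto simp: Z_def)
  from this[of x y] this[of y z] this[of x z] show False using xyz by auto
qed

text \<open>One side is free of centres. The other then consists of centres, as a path vertex has
  only two path neighbours; but no path vertex is attached to two centres.\<close>

lemma no_star_path_complete_bipartite:
  assumes k: "2 \<le> k" and adj: "\<And>x y. x \<in> U \<Longrightarrow> y \<in> V \<Longrightarrow> star_path_adj b k x y"
    and card: "3 \<le> card U" "3 \<le> card V"
  shows False
proof -
  have main: False
    if adj: "\<And>x y. x \<in> U \<Longrightarrow> y \<in> V \<Longrightarrow> star_path_adj b k x y"
      and card: "3 \<le> card U" "3 \<le> card V" and V: "\<And>y. y \<in> V \<Longrightarrow> fst y \<noteq> 0" for U V
  proof -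
    have U: "fst x = 0" if x: "x \<in> U" for x
    proof (rule ccontr)
      assume nz: "fst x \<noteq> 0"
      have "V \<subseteq> {(fst x, Suc (snd x)), (fst x, snd x - 1)}"
      proof
        fix y assume y: "y \<in> V"
        show "y \<in> {(fst x, Suc (snd x)), (fst x, snd x - 1)}"
          using adj[OF x y] V[OF y] nz
          by (cases y) (auto simp: star_path_adj_def star_path_step_def)
      qed
      then have "card V \<le> card {(fst x, Suc (snd x)), (fst x, snd x - 1)}"
        by (intro card_mono) auto
      then show False using card(2) by (simp add: card_insert_if split: if_splits)
    qed
    have "\<not> card U \<le> Suc 0" "finite U" using card by (auto intro: card_ge_0_finite)
    then obtain x x' where x: "x \<in> U" "x' \<in> U" "x \<noteq> x'" by (auto simp: card_le_Suc0_iff_eq)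
    have "V \<noteq> {}" using card by auto
    then obtain y where y: "y \<in> V" by blast
    have "x = (0, snd x)" "x' = (0, snd x')" using U x by (auto simp: prod_eq_iff)
    then have "snd y = k * snd x \<or> snd y = Suc (k * snd x)" "snd y = k * snd x' \<or> snd y = Suc (k * snd x')"
      using adj[OF x(1) y] adj[OF x(2) y] star_path_adj_centre[of b k "snd x" y]
        star_path_adj_centre[of b k "snd x'" y] by auto
    then have "k * snd x = k * snd x'"
      using mult_neq_Suc_mult[OF k, of "snd x" "snd x'"] mult_neq_Suc_mult[OF k, of "snd x'" "snd x"] by auto
    then show False using k x U by (auto simp: prod_eq_iff)
  qed
  show False
  proof (cases "\<exists>y\<in>V. fst y = 0")
    case True
    then obtain y where y: "y \<in> V" "fst y = 0" by blast
    have "fst x \<noteq> 0" if "x \<in> U" for x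
      using adj[OF that y(1)] y(2) by (auto simp: star_path_adj_def star_path_step_def)
    then show False using main[of V U] adj card star_path_adj_sym by metis
  next
    case False
    then show False by (intro main[of U V] adj card) auto
  qed
qed

text \<open>The constant: degree at most 4 gives cuts of size at most 4 and fibres with at most 5
  branching vertices, doubled to 10 on the way back from a line graph. A wall forces
  \<open>t - 4 - 2 * 4\<close> of them into one fibre, which is 11 for
  \<open>t = 23\<close>.\<close>

theorem star_path_graph_clean:
  assumes k: "2 \<le> k"
  shows "t_clean 23 (with_proj (star_path_graph b k n))"
  unfolding t_clean_def
proof (rule notI, elim exE conjE)
  fix B assume B: "induced_subgraph B (with_proj (star_path_graph b k n))" "basic_obstruction 23 B"
  have arcsB: "arcs_ends B = {(u, v) \<in> parcs (star_path_graph b k n). u \<in> verts B \<and> v \<in> verts B}"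
    using B(1) by (auto simp: arcs_ends_conv induced_subgraph_def subgraph_def compatible_def)
  have adjB: "star_path_adj b k (prod_decode u) (prod_decode v)" if "(u, v) \<in> arcs_ends B" for u v
    using that by (auto simp: arcsB star_path_graph_def)
  have card_dec: "card (prod_decode ` X) = card X" for X
    by (intro card_image inj_on_subset[OF inj_prod_decode]) auto
  consider "complete_digraph 23 B" | "complete_bipartite_digraph 23 23 B"
    | S where "subdivision_pair (wall 23) S" "digraph_iso (with_proj S) B"
    | S where "subdivision_pair (wall 23) S" "digraph_iso (with_proj (line_graph S)) B"
    using B(2) unfolding basic_obstruction_def by blast
  then show False
  proof cases
    case 1
    have "card (prod_decode ` verts B) < 4"
    proof (rule no_star_path_complete)
      fix x y assume xy: "x \<in> prod_decode ` verts B" "y \<in> prod_decode ` verts B" "x \<noteq> y"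
      then obtain u v where "u \<in> verts B" "v \<in> verts B" "x = prod_decode u" "y = prod_decode v" by blast
      then show "star_path_adj b k x y" using 1 xy(3) adjB by (auto simp: complete_digraph_def)
    qed
    then show False using 1 by (simp add: card_dec complete_digraph_def)
  next
    case 2
    then obtain U V where UV: "card U = 23" "card V = 23" "arcs_ends B = U \<times> V \<union> V \<times> U"
      by (auto simp: complete_bipartite_digraph_def)
    show False
    proof (rule no_star_path_complete_bipartite[OF k])
      show "star_path_adj b k x y" if "x \<in> prod_decode ` U" "y \<in> prod_decode ` V" for x y
        using that UV(3) adjB by blast
    qed (simp_all add: card_dec UV)
  next
    case (3 S)
    note inv = subdivision_pair_invariants[OF 3(1) pair_graph_wall]
    \<comment> \<open>The bound 4 instead of 3 yields the same constants as in the line graph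
      case.\<close>
    have deg: "card (parcs S `` {v}) \<le> 4" if "v \<in> pverts S" for v
      using inv(3)[of v] inv(4)[of v] card_neighbours_wall[of 23 v] that by (cases "v \<in> pverts (wall 23)") auto
    obtain \<phi> where \<phi>: "inj_on \<phi> (pverts S)"
        "\<And>u v. u \<in> pverts S \<Longrightarrow> v \<in> pverts S \<Longrightarrow> (u, v) \<in> parcs S \<longleftrightarrow> star_path_adj b k (\<phi> u) (\<phi> v)"
      by (rule star_path_graph_embedding[OF B(1) 3(2)]) blast
    obtain f where f: "\<And>c. card (cut_arcs S f c) \<le> 4"
        "\<And>c. card {v \<in> pverts S. branching S v \<and> f v = c} \<le> Suc 4"
      by (rule star_path_layout[OF inv(1) k \<phi> deg]) blast+
    obtain c where c: "23 - 4 - 2 * 4 \<le> card {v \<in> pverts (wall 23). 3 \<le> card (parcs (wall 23) `` {v}) \<and> f v = c}"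
      by (rule wall_layout_fibre[of 23 f 4]) (auto intro: order.trans[OF inv(5) f(1)])
    also have "\<dots> \<le> card {v \<in> pverts S. branching S v \<and> f v = c}"
      using inv(2,3) pair_graphD(1)[OF inv(1)] by (intro card_mono) (auto simp: branching_def)
    also have "\<dots> \<le> Suc 4" by (rule f)
    finally show False by simp
  next
    case (4 S)
    note inv = subdivision_pair_invariants[OF 4(1) pair_graph_wall]
    have deg: "card (parcs S `` {v}) \<le> Suc 2" if "v \<in> pverts S" for v
      using inv(3)[of v] inv(4)[of v] card_neighbours_wall[of 23 v] that by (cases "v \<in> pverts (wall 23)") auto
    have deg': "card (parcs (line_graph S) `` {e}) \<le> 4" if "e \<in> pverts (line_graph S)" for e
      using card_neighbours_line_graph[OF inv(1) deg that] by simp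
    let ?L = "line_graph S"
    obtain \<phi> where \<phi>: "inj_on \<phi> (pverts ?L)"
        "\<And>u v. u \<in> pverts ?L \<Longrightarrow> v \<in> pverts ?L \<Longrightarrow> (u, v) \<in> parcs ?L \<longleftrightarrow> star_path_adj b k (\<phi> u) (\<phi> v)"
      by (rule star_path_graph_embedding[OF B(1) 4(2)]) blast
    obtain f where f: "\<And>c. card (cut_arcs ?L f c) \<le> 4"
        "\<And>c. card {v \<in> pverts ?L. branching ?L v \<and> f v = c} \<le> Suc 4"
      by (rule star_path_layout[OF pair_graph_line_graph[OF inv(1)] k \<phi> deg']) blast+
    obtain g where g: "\<And>c. card (cut_arcs S g c) \<le> 4"
        "\<And>c. card {v \<in> pverts S. 3 \<le> card (parcs S `` {v}) \<and> g v = c} \<le> 2 * Suc 4"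
      by (rule layout_of_line_graph[OF inv(1) f]) blast+
    obtain c where c: "23 - 4 - 2 * 4 \<le> card {v \<in> pverts (wall 23). 3 \<le> card (parcs (wall 23) `` {v}) \<and> g v = c}"
      by (rule wall_layout_fibre[of 23 g 4]) (auto intro: order.trans[OF inv(5) g(1)])
    also have "\<dots> \<le> card {v \<in> pverts S. 3 \<le> card (parcs S `` {v}) \<and> g v = c}"
      using inv(2,3) pair_graphD(1)[OF inv(1)] by (intro card_mono) auto
    also have "\<dots> \<le> 2 * Suc 4" by (rule g)
    finally show False by simp
  qed
qed

section \<open>Treewidth\<close>

text \<open>A cycle given by its vertices; the length bound excludes the walk along one edge and
  back.\<close>

definition closed_path :: "'a rel \<Rightarrow> 'a list \<Rightarrow> bool" where
  "closed_path E vs \<longleftrightarrow> 3 \<le> length vs \<and> distinct vs \<and>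
     successively (\<lambda>x y. (x, y) \<in> E) vs \<and> (last vs, hd vs) \<in> E"

lemma forest_no_closed_path:
  assumes G: "pair_graph G" and forest: "undirected_forest (with_proj G)"
  shows "\<not> closed_path (parcs G) vs"
proof
  assume vs: "closed_path (parcs G) vs"
  \<comment> \<open>The arcs of the vertex walk \<open>xs\<close> continued to \<open>y\<close>;
    choosing \<open>y = hd xs\<close> closes it up.\<close>
  define walk where "walk xs y = zip xs (tl xs @ [y])" for xs and y :: 'a
  have walk: "pcas (hd xs) (walk xs y) y \<and> pawalk_verts u (walk xs y) = xs @ [y] \<and> length (walk xs y) = length xs \<and>
      (successively (\<lambda>x y. (x, y) \<in> parcs G) xs \<longrightarrow> (last xs, y) \<in> parcs G \<longrightarrow> set (walk xs y) \<subseteq> parcs G)"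
    if "xs \<noteq> []" for xs y u
    using that
  proof (induction xs arbitrary: u rule: list_nonempty_induct)
    case (single x)
    show ?case by (simp add: walk_def)
  next
    case (cons x xs)
    have eq: "walk (x # xs) y = (x, hd xs) # walk xs y"
      using cons.hyps by (cases xs) (auto simp: walk_def)
    show ?case using cons by (auto simp: eq successively_Cons)
  qed
  interpret pair_graph G by fact
  have ne: "vs \<noteq> []" using vs by (auto simp: closed_path_def)
  note w = walk[OF ne, of "hd vs" "hd vs"]
  have arcs: "set (walk vs (hd vs)) \<subseteq> parcs G" using w vs by (auto simp: closed_path_def)
  have "(last vs, hd vs) \<in> parcs G" using vs by (simp add: closed_path_def)
  then have "hd vs \<in> pverts G" by (rule pair_graphD(5)[OF G])
  then have "awalk (hd vs) (walk vs (hd vs)) (hd vs)" using w arcs by (simp add: awalk_def)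
  moreover have "distinct (tl (vs @ [hd vs]))"
    using vs ne by (cases vs) (auto simp: closed_path_def)
  moreover have "walk vs (hd vs) \<noteq> []" using w ne by force
  ultimately have "cycle (walk vs (hd vs))" unfolding cycle_def using w by auto
  moreover have "3 \<le> length (walk vs (hd vs))" using w vs by (simp add: closed_path_def)
  ultimately show False using forest by (auto simp: undirected_forest_def)
qed

text \<open>Take the first vertex of a longest path. By maximality its neighbours lie on the path,
  and any other than the second vertex would close a cycle.\<close>

lemma leaf_exists:
  assumes fin: "finite V" and ne: "V \<noteq> {}" and sym: "sym E" and irr: "irrefl E"
    and acyc: "\<And>vs. \<not> closed_path E vs"
  obtains l z where "l \<in> V" "\<And>y. y \<in> V \<Longrightarrow> (l, y) \<in> E \<Longrightarrow> y = z"
proof -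
  define P where "P vs \<longleftrightarrow> vs \<noteq> [] \<and> distinct vs \<and> set vs \<subseteq> V \<and> successively (\<lambda>x y. (x, y) \<in> E) vs" for vs
  obtain v where "v \<in> V" using ne by blast
  then have "P [v]" by (simp add: P_def)
  moreover have "length vs < Suc (card V)" if "P vs" for vs
    using that fin card_mono[of V "set vs"] by (auto simp: P_def distinct_card)
  ultimately obtain vs where vs: "P vs" "\<And>ws. P ws \<Longrightarrow> length ws \<le> length vs"
    using ex_has_greatest_nat[of P "[v]" length "Suc (card V)"] by (metis less_imp_le)
  obtain x xs where x: "vs = x # xs" using vs(1) by (cases vs) (auto simp: P_def)
  show thesis
  proof (rule that)
    show "x \<in> V" using vs(1) x by (auto simp: P_def)
    fix y assume y: "y \<in> V" "(x, y) \<in> E"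
    have "y \<in> set vs"
    proof (rule ccontr)
      assume "y \<notin> set vs"
      then have "P (y # vs)" using vs(1) y sym x by (auto simp: P_def successively_Cons sym_def)
      then show False using vs(2) by fastforce
    qed
    moreover have "y \<noteq> x" using y(2) irr by (auto simp: irrefl_def)
    ultimately obtain i where i: "i < length xs" "y = xs ! i" using x by (auto simp: in_set_conv_nth)
    have "i = 0"
    proof (rule ccontr)
      assume i0: "i \<noteq> 0"
      \<comment> \<open>The initial segment of the path from \<open>x\<close> to \<open>y\<close>,
        closed up by the edge between them.\<close>
      define ws where "ws = take (Suc (Suc i)) vs"
      have len: "length ws = Suc (Suc i)" using i x by (simp add: ws_def)
      then have "ws \<noteq> []" by auto
      then have "last ws = ws ! Suc i" using len by (simp add: last_conv_nth)
      then have "last ws = y" using i x by (simp add: ws_def)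
      moreover have "hd ws = x" by (simp add: ws_def x)
      moreover have "distinct ws" using vs(1) by (simp add: ws_def P_def)
      moreover have "successively (\<lambda>x y. (x, y) \<in> E) ws"
        using vs(1) append_take_drop_id[of "Suc (Suc i)" vs] unfolding P_def ws_def
        by (metis successively_append_iff)
      ultimately have "closed_path E ws"
        using len i0 y(2) sym by (auto simp: closed_path_def sym_def)
      then show False using acyc by blast
    qed
    \<comment> \<open>For empty \<open>xs\<close> this witness is unspecified, but then
      \<open>x\<close> has no neighbour in \<open>V\<close>.\<close>
    then show "y = xs ! 0" using i by simp
  qed
qed

section \<open>Connected subsets and the Helly property of subtrees\<close>

definition connected_in :: "'a rel \<Rightarrow> 'a set \<Rightarrow> bool" where
  "connected_in E A \<longleftrightarrow> (\<forall>x\<in>A. \<forall>y\<in>A. (x, y) \<in> rtrancl_on A E)"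

text \<open>A walk can reach and leave \<open>l\<close> only through \<open>z\<close>, so visits to
  \<open>l\<close> can be cut out.\<close>

lemma connected_in_remove_leaf:
  assumes conn: "connected_in E A" and sym: "sym E"
    and leaf: "\<And>y. y \<in> A \<Longrightarrow> (l, y) \<in> E \<Longrightarrow> y = z"
  shows "connected_in E (A - {l})"
  unfolding connected_in_def
proof (intro ballI)
  fix x y assume x: "x \<in> A - {l}" and y: "y \<in> A - {l}"
  have "(x, y) \<in> rtrancl_on A E" using conn x y by (auto simp: connected_in_def)
  \<comment> \<open>While the walk sits at \<open>l\<close>, the invariant keeps the shortened walk
    waiting at \<open>z\<close>.\<close>
  then have "(y \<noteq> l \<longrightarrow> (x, y) \<in> rtrancl_on (A - {l}) E) \<and> (y = l \<longrightarrow> (x, z) \<in> rtrancl_on (A - {l}) E)"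
  proof (induction rule: rtrancl_on_induct)
    case base
    then show ?case using x by auto
  next
    case (step y w)
    have "(w, y) \<in> E" using step(2) sym by (auto simp: sym_def)
    then show ?case using step leaf[of y] leaf[of w]
      by (auto intro: rtrancl_on_into_rtrancl_on)
  qed
  then show "(x, y) \<in> rtrancl_on (A - {l}) E" using y by auto
qed

text \<open>Induction by deleting a leaf \<open>l\<close>. If \<open>{l}\<close> is a member,
  \<open>l\<close> is the common point; otherwise every member through \<open>l\<close> also
  contains its neighbour, so the members still meet pairwise after the deletion.\<close>

lemma Helly_subtrees:
  assumes "finite V" and sym: "sym E" and irr: "irrefl E" and acyc: "\<And>vs. \<not> closed_path E vs"
    and "F \<noteq> {}" and "\<And>A. A \<in> F \<Longrightarrow> A \<subseteq> V" and "\<And>A. A \<in> F \<Longrightarrow> connected_in E A"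
    and "\<And>A B. A \<in> F \<Longrightarrow> B \<in> F \<Longrightarrow> A \<inter> B \<noteq> {}"
  shows "\<exists>x\<in>V. \<forall>A\<in>F. x \<in> A"
  using assms(1,5-8)
proof (induction V arbitrary: F rule: finite_psubset_induct)
  case (psubset V)
  have ne: "A \<noteq> {}" if "A \<in> F" for A using psubset.prems(4)[OF that that] by simp
  obtain A0 where "A0 \<in> F" using psubset.prems(1) by blast
  then have "V \<noteq> {}" using psubset.prems(2) ne by blast
  then obtain l z where l: "l \<in> V" and leaf: "\<And>y. y \<in> V \<Longrightarrow> (l, y) \<in> E \<Longrightarrow> y = z"
    using leaf_exists[OF psubset.hyps _ sym irr acyc] by metis
  show ?case
  proof (cases "{l} \<in> F")
    case True
    then have "l \<in> A" if "A \<in> F" for A using psubset.prems(4)[OF True that] by simp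
    then show ?thesis using l by blast
  next
    case False
    \<comment> \<open>\<open>A\<close> has a further element reachable from \<open>l\<close> inside
      \<open>A\<close>, and the first step of that walk can only lead to \<open>z\<close>.\<close>
    have z: "z \<in> A \<and> z \<noteq> l" if A: "A \<in> F" "l \<in> A" for A
    proof -
      have "A \<noteq> {l}" using False A(1) by blast
      then obtain a where a: "a \<in> A" "a \<noteq> l" using A(2) by blast
      have "(l, a) \<in> rtrancl_on A E" using psubset.prems(3)[OF A(1)] A(2) a(1) by (auto simp: connected_in_def)
      then obtain c where c: "(l, c) \<in> E" "c \<in> A"
        using a(2) in_rtrancl_on_in_F(1) by (cases rule: converse_rtrancl_on_cases) fastforce+
      then have "c = z" using leaf psubset.prems(2)[OF A(1)] by blast
      then show ?thesis using c irr by (auto simp: irrefl_def)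
    qed
    have "\<exists>x\<in>V - {l}. \<forall>A\<in>(\<lambda>A. A - {l}) ` F. x \<in> A"
    proof (rule psubset.IH)
      show "V - {l} \<subset> V" using l by auto
      show "(\<lambda>A. A - {l}) ` F \<noteq> {}" using psubset.prems(1) by simp
      show "A \<subseteq> V - {l}" if "A \<in> (\<lambda>A. A - {l}) ` F" for A
        using that psubset.prems(2) by blast
      show "connected_in E A" if A: "A \<in> (\<lambda>A. A - {l}) ` F" for A
      proof -
        obtain A' where A': "A' \<in> F" "A = A' - {l}" using A by blast
        have "y = z" if "y \<in> A'" "(l, y) \<in> E" for y
          using leaf that psubset.prems(2)[OF A'(1)] by blast
        then show ?thesis
          unfolding A'(2) by (rule connected_in_remove_leaf[OF psubset.prems(3)[OF A'(1)] sym])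
      qed
      show "A \<inter> B \<noteq> {}" if AB: "A \<in> (\<lambda>A. A - {l}) ` F" "B \<in> (\<lambda>A. A - {l}) ` F" for A B
      proof -
        obtain A' B' where *: "A' \<in> F" "B' \<in> F" "A = A' - {l}" "B = B' - {l}" using AB by blast
        obtain x where x: "x \<in> A'" "x \<in> B'" using psubset.prems(4)[OF *(1,2)] by blast
        show ?thesis
        proof (cases "x = l")
          case True
          then show ?thesis using z[OF *(1)] z[OF *(2)] x * by blast
        next
          case False
          then show ?thesis using x * by blast
        qed
      qed
    qed
    then obtain x where "x \<in> V - {l}" "\<And>A. A \<in> F \<Longrightarrow> x \<in> A - {l}" by auto
    then show ?thesis by (intro bexI[of _ x]) auto
  qed
qed

text \<open>The easy half of bramble duality. The nodes whose bags meet a bramble set form a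
  subtree, an edge between two sets makes their subtrees intersect, and the Helly property gives a
  common node.\<close>

lemma bramble_bag:
  assumes G: "pair_graph G" and dec: "tree_decomposition G T \<beta>" and "F \<noteq> {}"
    and sub: "\<And>B. B \<in> F \<Longrightarrow> B \<subseteq> pverts G"
    and conn: "\<And>B. B \<in> F \<Longrightarrow> connected_in (parcs G) B"
    and touch: "\<And>B C. B \<in> F \<Longrightarrow> C \<in> F \<Longrightarrow> \<exists>u\<in>B. \<exists>v\<in>C. (u, v) \<in> parcs G"
  obtains x where "x \<in> pverts T" "\<And>B. B \<in> F \<Longrightarrow> \<beta> x \<inter> B \<noteq> {}"
proof -
  have T: "pair_graph T" and forest: "undirected_forest (with_proj T)"
    and cover: "(\<Union>x \<in> pverts T. \<beta> x) = pverts G"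
    and edge: "\<And>u v. (u, v) \<in> parcs G \<Longrightarrow> \<exists>x \<in> pverts T. u \<in> \<beta> x \<and> v \<in> \<beta> x"
    and bag: "\<And>v. v \<in> pverts G \<Longrightarrow> Digraph_Component.connected (with_proj T \<restriction> {x \<in> pverts T. v \<in> \<beta> x})"
    using dec by (auto simp: tree_decomposition_def undirected_tree_def)
  have symT: "sym (parcs T)" and irrT: "irrefl (parcs T)"
    using pair_graphD(6,7)[OF T] by (auto simp: sym_def irrefl_def)
  define N where "N B = {x \<in> pverts T. \<beta> x \<inter> B \<noteq> {}}" for B
  have single: "(x, y) \<in> rtrancl_on {x \<in> pverts T. v \<in> \<beta> x} (parcs T)"
    if "v \<in> pverts G" "x \<in> pverts T" "y \<in> pverts T" "v \<in> \<beta> x" "v \<in> \<beta> y" for v x y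
  proof -
    have reach: "(x, y) \<in> rtrancl_on {x \<in> pverts T. v \<in> \<beta> x} ((arcs_ends (with_proj T \<restriction> {x \<in> pverts T. v \<in> \<beta> x}))\<^sup>s)"
      using bag[OF that(1)] that by (auto simp: connected_conv)
    have "(arcs_ends (with_proj T \<restriction> {x \<in> pverts T. v \<in> \<beta> x}))\<^sup>s \<subseteq> parcs T"
      using symT by (auto simp: symcl_def arcs_ends_conv sym_def)
    then show ?thesis using order_refl reach by (rule rtrancl_on_mono)
  qed
  have "connected_in (parcs T) (N B)" if B: "B \<in> F" for B
    unfolding connected_in_def
  proof (intro ballI)
    fix x y assume x: "x \<in> N B" and y: "y \<in> N B"
    obtain u v where uv: "u \<in> \<beta> x" "u \<in> B" "v \<in> \<beta> y" "v \<in> B" using x y by (auto simp: N_def)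
    have within: "(a, b) \<in> rtrancl_on (N B) (parcs T)"
      if "w \<in> B" "a \<in> pverts T" "b \<in> pverts T" "w \<in> \<beta> a" "w \<in> \<beta> b" for w a b
    proof (rule rtrancl_on_mono)
      show "(a, b) \<in> rtrancl_on {x \<in> pverts T. w \<in> \<beta> x} (parcs T)"
        using that sub[OF B] by (intro single) auto
      show "{x \<in> pverts T. w \<in> \<beta> x} \<subseteq> N B" using that by (auto simp: N_def)
    qed simp
    have "(u, v) \<in> rtrancl_on B (parcs G)" using conn[OF B] uv by (auto simp: connected_in_def)
    \<comment> \<open>Along a walk inside \<open>B\<close>, each edge lies in a common bag, which
      links the subtrees of its two ends.\<close>
    then have "\<forall>y\<in>pverts T. v \<in> \<beta> y \<longrightarrow> (x, y) \<in> rtrancl_on (N B) (parcs T)"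
    proof (induction rule: rtrancl_on_induct)
      case base
      then show ?case using within[of u x] x uv by (auto simp: N_def)
    next
      case (step v w)
      obtain a where a: "a \<in> pverts T" "v \<in> \<beta> a" "w \<in> \<beta> a" using edge[OF step(2)] by blast
      show ?case
      proof (intro ballI impI)
        fix y assume "y \<in> pverts T" "w \<in> \<beta> y"
        then have "(a, y) \<in> rtrancl_on (N B) (parcs T)" using within step a by blast
        moreover have "(x, a) \<in> rtrancl_on (N B) (parcs T)" using step a by blast
        ultimately show "(x, y) \<in> rtrancl_on (N B) (parcs T)" using rtrancl_on_trans by metis
      qed
    qed
    then show "(x, y) \<in> rtrancl_on (N B) (parcs T)" using y uv by (auto simp: N_def)
  qed
  moreover have "N B \<inter> N C \<noteq> {}" if "B \<in> F" "C \<in> F" for B C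
    using touch[OF that] edge by (fastforce simp: N_def)
  ultimately have "\<exists>x\<in>pverts T. \<forall>A\<in>N ` F. x \<in> A"
    using Helly_subtrees[OF pair_graphD(1)[OF T] symT irrT forest_no_closed_path[OF T forest], of "N ` F"] \<open>F \<noteq> {}\<close>
    by (fastforce simp: N_def)
  then obtain x where "x \<in> pverts T" "\<forall>B\<in>F. x \<in> N B" by blast
  then show thesis by (intro that) (auto simp: N_def)
qed

text \<open>Ensures that the \<open>LEAST\<close> in \<open>treewidth\<close> is attained. A single
  node carrying all vertices suffices.\<close>

lemma tree_decomposition_exists:
  assumes G: "pair_graph G"
  shows "\<exists>T \<beta>. tree_decomposition G T \<beta>"
proof (intro exI)
  let ?T = "\<lparr>pverts = {0::nat}, parcs = {}\<rparr>"
  have "pair_graph ?T" by unfold_locales (auto simp: symmetric_def sym_def)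
  moreover have "undirected_forest (with_proj ?T)"
    by (auto simp: undirected_forest_def pre_digraph.cycle_def pre_digraph.awalk_def)
  moreover have "Digraph_Component.connected (with_proj ?T)" by (auto simp: connected_conv)
  moreover have "Digraph_Component.connected (with_proj ?T \<restriction> {0})" by (auto simp: connected_conv)
  ultimately show "tree_decomposition G ?T (\<lambda>_. pverts G)"
    using G by (auto simp: tree_decomposition_def undirected_tree_def dest: pair_graphD(4,5) cong: conj_cong)
qed

text \<open>The strict inequality absorbs the 1 subtracted in
  \<open>decomposition_width\<close>.\<close>

lemma treewidth_ge:
  assumes G: "pair_graph G"
    and bag: "\<And>T \<beta>. tree_decomposition G T \<beta> \<Longrightarrow> \<exists>x\<in>pverts T. n < card (\<beta> x)"
  shows "n \<le> treewidth G"
proof -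
  have "\<exists>T \<beta>. tree_decomposition G T \<beta> \<and> decomposition_width T \<beta> = treewidth G"
    unfolding treewidth_def by (rule LeastI_ex) (use tree_decomposition_exists[OF G] in blast)
  then obtain T \<beta> where dec: "tree_decomposition G T \<beta>" "decomposition_width T \<beta> = treewidth G"
    by blast
  obtain x where x: "x \<in> pverts T" "n < card (\<beta> x)" using bag[OF dec(1)] by blast
  have "finite (pverts T)" using dec(1) pair_graphD(1) by (auto simp: tree_decomposition_def)
  then have "card (\<beta> x) \<le> Max ((\<lambda>x. card (\<beta> x)) ` pverts T)" using x(1) by simp
  then show ?thesis using x(2) dec(2) by (auto simp: decomposition_width_def)
qed

section \<open>The bramble of a star-path graph\<close>

lemma connected_in_image:
  assumes conn: "connected_in E A" and hom: "\<And>x y. x \<in> A \<Longrightarrow> y \<in> A \<Longrightarrow> (x, y) \<in> E \<Longrightarrow> (h x, h y) \<in> E'"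
  shows "connected_in E' (h ` A)"
proof -
  have "(h x, h y) \<in> rtrancl_on (h ` A) E'" if "(x, y) \<in> rtrancl_on A E" for x y
    using that
  proof (induction rule: rtrancl_on_induct)
    case (step y z)
    then show ?case by (intro rtrancl_on_into_rtrancl_on[OF step.IH]) (auto intro: hom)
  qed auto
  then show ?thesis using conn by (auto simp: connected_in_def)
qed

lemma treewidth_star_path_graph: "n \<le> treewidth (star_path_graph b k (Suc n))"
proof (rule treewidth_ge[OF pair_graph_star_path_graph])
  let ?G = "star_path_graph b k (Suc n)"
  define B where "B i j = insert (0, i) ({j} \<times> {..<k * Suc n + 2})" for i j :: nat
  define F where "F = {prod_encode ` B i j | i j. i < Suc n \<and> j \<in> {1..Suc n}}"
  fix T \<beta> assume dec: "tree_decomposition ?G T \<beta>"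
  have Bsub: "B i j \<subseteq> star_path_verts k (Suc n)" if "i < Suc n" "j \<in> {1..Suc n}" for i j
    using that by (auto simp: B_def star_path_verts_def)
  have arc: "(prod_encode x, prod_encode y) \<in> parcs ?G"
    if "x \<in> star_path_verts k (Suc n)" "y \<in> star_path_verts k (Suc n)" "star_path_adj b k x y" for x y
    using that by (simp add: star_path_graph_def)
  have centre_pos: "k * i < k * Suc n + 2" if "i < Suc n" for i
  proof -
    have "k * i \<le> k * Suc n" using that by (intro mult_le_mono) auto
    then show ?thesis by simp
  qed
  have connB: "connected_in {(x, y). star_path_adj b k x y} (B i j)" if ij: "i < Suc n" "j \<in> {1..Suc n}" for i j
  proof -
    let ?E = "{(x, y). star_path_adj b k x y}"
    have path: "((j, 0), (j, p)) \<in> rtrancl_on (B i j) ?E" if "p < k * Suc n + 2" for p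
      using that
    proof (induction p)
      case 0
      show ?case by (auto simp: B_def)
    next
      case (Suc p)
      then have "((j, 0), (j, p)) \<in> rtrancl_on (B i j) ?E" by simp
      then show ?case
        by (rule rtrancl_on_into_rtrancl_on) (use ij Suc in \<open>auto simp: B_def star_path_adj_path\<close>)
    qed
    have "((j, 0), (0, i)) \<in> rtrancl_on (B i j) ?E"
      by (rule rtrancl_on_into_rtrancl_on[OF path[OF centre_pos[OF ij(1)]]])
         (use ij in \<open>auto simp: B_def star_path_adj_centre star_path_adj_sym[of b k "(j, k * i)"]\<close>)
    then have reach: "((j, 0), x) \<in> rtrancl_on (B i j) ?E" if "x \<in> B i j" for x
      using that path by (auto simp: B_def)
    have "sym (rtrancl_on (B i j) ?E)"
      by (rule rtrancl_on_sym) (auto simp: sym_def star_path_adj_sym)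
    then show ?thesis
      unfolding connected_in_def using reach rtrancl_on_trans by (metis symD)
  qed
  obtain x where x: "x \<in> pverts T" "\<And>X. X \<in> F \<Longrightarrow> \<beta> x \<inter> X \<noteq> {}"
  proof (rule bramble_bag[OF pair_graph_star_path_graph dec, of F])
    show "F \<noteq> {}" by (force simp: F_def)
    show "X \<subseteq> pverts ?G" if "X \<in> F" for X
      using that Bsub by (fastforce simp: F_def star_path_graph_def)
    show "connected_in (parcs ?G) X" if "X \<in> F" for X
    proof -
      obtain i j where ij: "i < Suc n" "j \<in> {1..Suc n}" "X = prod_encode ` B i j"
        using \<open>X \<in> F\<close> by (auto simp: F_def)
      show ?thesis unfolding ij(3)
        by (rule connected_in_image[OF connB[OF ij(1,2)]]) (use Bsub[OF ij(1,2)] in \<open>auto intro: arc\<close>)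
    qed
    show "\<exists>u\<in>X. \<exists>v\<in>Y. (u, v) \<in> parcs ?G" if XY: "X \<in> F" "Y \<in> F" for X Y
    proof -
      obtain i j where ij: "i < Suc n" "j \<in> {1..Suc n}" "X = prod_encode ` B i j"
        using XY(1) by (auto simp: F_def)
      obtain i' j' where ij': "i' < Suc n" "j' \<in> {1..Suc n}" "Y = prod_encode ` B i' j'"
        using XY(2) by (auto simp: F_def)
      have 1: "(0, i) \<in> B i j" "(j', k * i) \<in> B i' j'"
        using centre_pos[OF ij(1)] by (auto simp: B_def)
      \<comment> \<open>The centre of the first set is attached to every path, in particular to that
        of the second, at position \<open>k * i\<close>.\<close>
      have "(prod_encode (0, i), prod_encode (j', k * i)) \<in> parcs ?G"
        using 1 Bsub[OF ij(1,2)] Bsub[OF ij'(1,2)] ij' by (intro arc) (auto simp: star_path_adj_centre)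
      then show ?thesis using 1 ij(3) ij'(3) by blast
    qed
  qed blast
  have "\<beta> x \<subseteq> pverts ?G" using dec x(1) by (auto simp: tree_decomposition_def)
  then have fin: "finite (\<beta> x)" using pair_graphD(1)[OF pair_graph_star_path_graph] finite_subset by blast
  have "n < card (\<beta> x)"
  \<comment> \<open>The bag contains all \<open>Suc n\<close> centres, or it misses centre
    \<open>i\<close> and must then meet each of the \<open>Suc n\<close> paths.\<close>
  proof (cases "\<forall>i < Suc n. prod_encode (0, i) \<in> \<beta> x")
    case True
    have "card ((\<lambda>i. prod_encode (0, i)) ` {..<Suc n}) \<le> card (\<beta> x)"
      using True fin by (intro card_mono) auto
    moreover have "card ((\<lambda>i. prod_encode (0, i)) ` {..<Suc n}) = Suc n"
      by (subst card_image) (auto simp: inj_on_def)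
    ultimately show ?thesis by simp
  next
    case False
    then obtain i where i: "i < Suc n" "prod_encode (0, i) \<notin> \<beta> x" by blast
    have "card {1..Suc n} \<le> card (\<beta> x)"
    proof (rule card_classes_met_le[OF fin, where h = "fst \<circ> prod_decode"])
      fix j assume j: "j \<in> {1..Suc n}"
      have "\<beta> x \<inter> prod_encode ` B i j \<noteq> {}" using i j by (intro x(2)) (auto simp: F_def)
      then obtain y where "y \<in> B i j" "prod_encode y \<in> \<beta> x" by blast
      then show "\<exists>y\<in>\<beta> x. (fst \<circ> prod_decode) y = j" using i(2) by (force simp: B_def)
    qed
    then show ?thesis by simp
  qed
  then show "\<exists>x\<in>pverts T. n < card (\<beta> x)" using x(1) by blast
qed

section \<open>Cycles and branch vertices\<close>

lemma cycle_closed_path: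
  assumes G: "pair_graph G" and cyc: "pre_digraph.cycle (with_proj G) p" and len: "3 \<le> length p"
  shows "closed_path (parcs G) (map fst p)"
proof -
  interpret pair_graph G by fact
  obtain u where u: "set p \<subseteq> parcs G" "pcas u p u" "distinct (tl (pawalk_verts u p))" "p \<noteq> []"
    using cyc by (auto simp: cycle_def awalk_def)
  have walk: "pawalk_verts u p = map fst p @ [w] \<and> fst (hd p) = u \<and> (fst (last p), w) \<in> set p \<and>
      successively (\<lambda>x y. (x, y) \<in> set p) (map fst p)"
    if "p \<noteq> []" "pcas u p w" for p :: "('a \<times> 'a) list" and u w
    using that
  proof (induction p arbitrary: u rule: list_nonempty_induct)
    case (single e)
    then show ?case by auto
  next
    case (cons e p)
    then have "pcas (snd e) p w" "fst e = u" by auto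
    with cons.IH[of "snd e"] have IH: "pawalk_verts (snd e) p = map fst p @ [w]" "fst (hd p) = snd e"
      "(fst (last p), w) \<in> set p" "successively (\<lambda>x y. (x, y) \<in> set p) (map fst p)" by blast+
    have "successively (\<lambda>x y. (x, y) \<in> set (e # p)) (map fst p)"
      using IH(4) by (rule successively_mono) auto
    moreover have "hd (map fst p) = snd e" using IH(2) cons.hyps by (simp add: hd_map)
    ultimately show ?case using IH cons.hyps \<open>fst e = u\<close> by (cases e) (auto simp: successively_Cons)
  qed
  note w = walk[OF u(4,2)]
  \<comment> \<open>The closed walk starts and ends at \<open>u\<close>, so distinctness after
    dropping its first vertex is distinctness of the sources.\<close>
  have "distinct (map fst p)"
    using u(3,4) w by (cases p) auto
  moreover have "successively (\<lambda>x y. (x, y) \<in> parcs G) (map fst p)"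
    using w u(1) by (auto intro: successively_mono)
  moreover have "(last (map fst p), hd (map fst p)) \<in> parcs G"
    using w u(1,4) by (auto simp: last_map hd_map)
  ultimately show ?thesis using len by (simp add: closed_path_def)
qed

text \<open>These are the cyclic predecessor and successor; length at least three makes them
  different.\<close>

lemma closed_path_two_neighbours:
  assumes vs: "closed_path E vs" and sym: "sym E" and v: "v \<in> set vs"
  obtains x y where "x \<in> set vs" "y \<in> set vs" "x \<noteq> y" "(v, x) \<in> E" "(v, y) \<in> E"
proof -
  obtain xs ys where split: "vs = xs @ v # ys" using v by (meson split_list)
  have E: "(a, b) \<in> E \<Longrightarrow> (b, a) \<in> E" for a b using sym by (auto simp: sym_def)
  have dist: "distinct vs" and len: "3 \<le> length vs" and close: "(last vs, hd vs) \<in> E"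
    and succ: "successively (\<lambda>x y. (x, y) \<in> E) vs"
    using vs by (auto simp: closed_path_def)
  have right: "(v, hd ys) \<in> E" if "ys \<noteq> []"
    using succ that split by (auto simp: successively_append_iff successively_Cons)
  have left: "(v, last xs) \<in> E" if "xs \<noteq> []"
    using succ that split E by (auto simp: successively_append_iff)
  consider "xs = []" | "ys = []" | "xs \<noteq> []" "ys \<noteq> []" by blast
  then show thesis
  proof cases
    case 1
    then obtain a b zs where ys: "ys = a # b # zs" using len split by (cases ys; cases "tl ys") auto
    have "(v, last ys) \<in> E" using close E 1 split ys by auto
    moreover have "last ys \<in> set (b # zs)" using last_in_set[of "b # zs"] ys by simp
    ultimately show thesis using that[of "hd ys" "last ys"] right dist split 1 ys by auto
  next
    case 2
    then have xs: "2 \<le> length xs" using len split by simp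
    then obtain a b zs where ab: "xs = a # b # zs" by (cases xs; cases "tl xs") auto
    have "(v, hd xs) \<in> E" using close 2 split ab by auto
    moreover have "last xs \<in> set (b # zs)" using last_in_set[of "b # zs"] ab by simp
    ultimately show thesis using that[of "hd xs" "last xs"] left dist split 2 ab by auto
  next
    case 3
    then have "last xs \<in> set xs" "hd ys \<in> set ys" by auto
    then have "last xs \<noteq> hd ys" using dist split by fastforce
    then show thesis using that[of "last xs" "hd ys"] left right 3 dist split by auto
  qed
qed

text \<open>
  The last vertex of \<open>C\<close> on a path must be attached to a centre, and from there \<open>C\<close> has to follow the
  path downwards until it meets the attachment of the previous centre.
\<close>

lemma star_path_min_degree_two_large:
  assumes k: "2 \<le> k" and fin: "finite C" and ne: "C \<noteq> {}"
    and two: "\<And>x. x \<in> C \<Longrightarrow> \<exists>y\<in>C. \<exists>z\<in>C. y \<noteq> z \<and> star_path_adj False k x y \<and> star_path_adj False k x z"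
  shows "k < card C"
proof -
  obtain x where x: "x \<in> C" using ne by blast
  have "\<exists>y\<in>C. 0 < fst y"
  proof (cases "fst x = 0")
    case True
    then obtain y where "y \<in> C" "star_path_adj False k x y" using two[OF x] by blast
    then show ?thesis using True star_path_adj_centre[of False k "snd x" y] by (cases x) auto
  qed (use x in auto)
  then obtain j p0 where j: "(j, p0) \<in> C" "0 < j" by (metis prod.collapse)
  define P where "P = {p. (j, p) \<in> C}"
  have "P \<subseteq> snd ` C" by (force simp: P_def)
  then have finP: "finite P" using fin finite_surj by blast
  define p where "p = Max P"
  have "p \<in> P" unfolding p_def using finP j by (intro Max_in) (auto simp: P_def)
  then have p: "(j, p) \<in> C" by (simp add: P_def)
  have max: "(j, Suc p) \<notin> C"
    using Max_ge[OF finP, of "Suc p"] by (auto simp: P_def p_def)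
  have nb: "y = (j, Suc q) \<or> (y = (j, q - 1) \<and> 0 < q) \<or> (fst y = 0 \<and> q = k * snd y)"
    if "star_path_adj False k (j, q) y" for y q
    using that j(2) by (cases y) (auto simp: star_path_adj_def star_path_step_def)
  obtain y z where yz: "y \<in> C" "z \<in> C" "y \<noteq> z" "star_path_adj False k (j, p) y" "star_path_adj False k (j, p) z"
    using two[OF p] by blast
  have y: "(y = (j, p - 1) \<and> 0 < p) \<or> (fst y = 0 \<and> p = k * snd y)"
    using nb[OF yz(4)] max yz(1) by auto
  have z: "(z = (j, p - 1) \<and> 0 < p) \<or> (fst z = 0 \<and> p = k * snd z)"
    using nb[OF yz(5)] max yz(2) by auto
  \<comment> \<open>Only one centre is attached at position \<open>p\<close>. As the path neighbour
    above is outside \<open>C\<close>, one neighbour is that centre and the other the vertex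
    below.\<close>
  have "\<not> (fst y = 0 \<and> fst z = 0 \<and> p = k * snd y \<and> p = k * snd z)"
    using yz(3) k by (auto simp: prod_eq_iff)
  then have down1: "(j, p - 1) \<in> C" "0 < p" and "\<exists>i. p = k * i"
    using y z yz(1-3) by auto
  then obtain i where i: "p = k * i" by blast
  have down: "r \<le> p \<and> (j, p - r) \<in> C" if "r \<le> k" for r
    using that
  proof (induction r)
    case 0
    show ?case using p by simp
  next
    case (Suc r)
    show ?case
    proof (cases "r = 0")
      case True
      then show ?thesis using down1 by simp
    next
      case False
      have r: "r \<le> p" "(j, p - r) \<in> C" using Suc by auto
      \<comment> \<open>For \<open>0 < r < k\<close> the position \<open>p - r\<close> lies strictly
        between consecutive multiples of \<open>k\<close>. No centre is attached there, so both
        neighbours in \<open>C\<close> are on the path.\<close>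
      have no: "p - r \<noteq> k * i'" for i'
      proof
        assume "p - r = k * i'"
        then have "k dvd p - r" "k dvd p" using i by auto
        then have "k dvd p - (p - r)" by (rule dvd_diff_nat[rotated])
        then have "k dvd r" using r(1) by simp
        then show False using False Suc.prems by (auto dest: dvd_imp_le)
      qed
      obtain y z where yz: "y \<in> C" "z \<in> C" "y \<noteq> z" "star_path_adj False k (j, p - r) y" "star_path_adj False k (j, p - r) z"
        using two[OF r(2)] by blast
      have "(j, p - r - 1) \<in> C \<and> 0 < p - r"
        using nb[OF yz(4)] nb[OF yz(5)] yz(1-3) no by auto
      then show ?thesis by auto
    qed
  qed
  have "inj_on (\<lambda>r. (j, p - r)) {..k}"
  proof (rule inj_onI)
    fix r r' assume "r \<in> {..k}" "r' \<in> {..k}" "(j, p - r) = (j, p - r')"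
    then show "r = r'" using down[of r] down[of r'] by auto
  qed
  moreover have "(\<lambda>r. (j, p - r)) ` {..k} \<subseteq> C" using down by auto
  ultimately have "card {..k} \<le> card C" using fin by (rule card_inj_on_le)
  then show ?thesis by simp
qed

section \<open>Branch vertices of embedded forests\<close>

lemma rtrancl_on_hits_intermediate:
  fixes g :: "'a \<Rightarrow> nat"
  assumes "(u, v) \<in> rtrancl_on V E" and "\<And>x y. x \<in> V \<Longrightarrow> y \<in> V \<Longrightarrow> (x, y) \<in> E \<Longrightarrow> g y \<le> Suc (g x)"
    and "g u \<le> q" "q \<le> g v"
  shows "q \<in> g ` V"
  using assms(1,4)
proof (induction rule: rtrancl_on_induct)
  case base
  then show ?case using assms(3) by force
next
  case (step y z)
  show ?case
  proof (cases "q \<le> g y")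
    case True
    then show ?thesis using step by blast
  next
    case False
    \<comment> \<open>Discrete intermediate value: a step raises \<open>g\<close> by at most one, so
      the first value to reach \<open>q\<close> equals it.\<close>
    then have "q = g z" using step assms(2)[of y z] by simp
    then show ?thesis using step by blast
  qed
qed

text \<open>A path vertex has at most two path neighbours and one centre. If all three are present,
  the centre also sees one of the path neighbours, which closes a triangle.\<close>

lemma star_path_branch_is_centre:
  assumes H: "pair_graph H" and k: "2 \<le> k" and forest: "undirected_forest (with_proj H)"
    and inj: "inj_on \<phi> (pverts H)"
    and emb: "\<And>u v. u \<in> pverts H \<Longrightarrow> v \<in> pverts H \<Longrightarrow>
                (u, v) \<in> parcs H \<longleftrightarrow> star_path_adj True k (\<phi> u) (\<phi> v)"
    and u: "u \<in> pverts H" "3 \<le> card (parcs H `` {u})"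
  shows "fst (\<phi> u) = 0"
proof (rule ccontr)
  assume nz: "fst (\<phi> u) \<noteq> 0"
  obtain j p where jp: "\<phi> u = (j, p)" by (cases "\<phi> u")
  have j: "0 < j" using nz jp by simp
  \<comment> \<open>The only candidate: both \<open>k * i\<close> and \<open>k * i + 1\<close> have
    quotient \<open>i\<close> by \<open>k\<close>.\<close>
  define i where "i = p div k"
  define X where "X = \<phi> ` (parcs H `` {u})"
  have nbV: "x \<in> pverts H" if "(u, x) \<in> parcs H" for x using pair_graphD(5)[OF H that] .
  have nb: "y = (j, Suc p) \<or> y = (j, p - 1) \<and> 0 < p \<or> y = (0, i) \<and> (p = k * i \<or> p = Suc (k * i))" if y: "y \<in> X" for y
  proof -
    obtain x where x: "(u, x) \<in> parcs H" "y = \<phi> x" using y by (auto simp: X_def)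
    have adj: "star_path_adj True k (j, p) y" using emb[OF u(1) nbV[OF x(1)]] x jp by simp
    show ?thesis
    proof (cases "fst y = 0")
      case True
      then have "p = k * snd y \<or> p = Suc (k * snd y)"
        using adj star_path_adj_sym[of True k "(j, p)" y] star_path_adj_centre[of True k "snd y" "(j, p)"]
        by (cases y) auto
      moreover from this have "i = snd y"
        unfolding i_def using k by (intro div_nat_eqI) auto
      ultimately show ?thesis using True by (cases y) auto
    next
      case False
      then show ?thesis using adj j by (cases y) (auto simp: star_path_adj_path)
    qed
  qed
  have "inj_on \<phi> (parcs H `` {u})" using inj by (rule inj_on_subset) (use nbV in auto)
  then have "3 \<le> card X" using u(2) by (simp add: X_def card_image)
  moreover have "X \<subseteq> {(j, Suc p), (j, p - 1), (0, i)}" using nb by blast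
  moreover have "card {(j, Suc p), (j, p - 1), (0, i)} \<le> 3" by (simp add: card_insert_if)
  ultimately have X: "X = {(j, Suc p), (j, p - 1), (0, i)}"
    by (intro card_seteq) auto
  have "p = k * i \<or> p = Suc (k * i)" using nb[of "(0, i)"] X j by auto
  \<comment> \<open>The other attachment of centre \<open>i\<close> on this path:
    \<open>Suc p\<close> if \<open>p = k * i\<close>, and \<open>p - 1\<close> otherwise.\<close>
  then have "\<exists>q. (j, q) \<in> X \<and> star_path_adj True k (0, i) (j, q)"
    using X j by (auto simp: star_path_adj_centre)
  then obtain q where q: "(j, q) \<in> X" "star_path_adj True k (0, i) (j, q)" by blast
  have "(0, i) \<in> X" using X by simp
  then obtain a where a: "(u, a) \<in> parcs H" "\<phi> a = (0, i)" by (auto simp: X_def)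
  obtain c where c: "(u, c) \<in> parcs H" "\<phi> c = (j, q)" using q(1) by (auto simp: X_def)
  have ac: "(a, c) \<in> parcs H" using emb[OF nbV[OF a(1)] nbV[OF c(1)]] a c q by simp
  have "(c, u) \<in> parcs H" using pair_graphD(6)[OF H c(1)] .
  moreover have "u \<noteq> a" "u \<noteq> c" "a \<noteq> c" using pair_graphD(7)[OF H] a c ac by blast+
  ultimately have "closed_path (parcs H) [u, a, c]" using a ac by (simp add: closed_path_def)
  then show False using forest_no_closed_path[OF H forest] by blast
qed

text \<open>The image of a cycle has minimum degree two, hence more than \<open>k\<close> vertices,
  too many for \<open>H\<close>.\<close>

lemma star_path_graph_free_of_cycle:
  assumes H: "pair_graph H" and k: "card (pverts H) \<le> k" "2 \<le> k"
    and cyc: "\<not> undirected_forest (with_proj H)"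
  shows "star_path_graph False k n \<in> free_class H"
proof -
  have False
    if I: "induced_subgraph I (with_proj (star_path_graph False k n))" "digraph_iso (with_proj H) I" for I
  proof -
    obtain \<phi> where \<phi>: "inj_on \<phi> (pverts H)"
        "\<And>u v. u \<in> pverts H \<Longrightarrow> v \<in> pverts H \<Longrightarrow> (u, v) \<in> parcs H \<longleftrightarrow> star_path_adj False k (\<phi> u) (\<phi> v)"
      by (rule star_path_graph_embedding[OF I]) blast
    obtain vs where vs: "closed_path (parcs H) vs"
      using cyc cycle_closed_path[OF H] by (auto simp: undirected_forest_def)
    have symH: "sym (parcs H)" using pair_graphD(6)[OF H] by (auto simp: sym_def)
    have sub: "set vs \<subseteq> pverts H"
      using closed_path_two_neighbours[OF vs symH] pair_graphD(4)[OF H] by (metis subsetI)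
    have "k < card (\<phi> ` set vs)"
    proof (rule star_path_min_degree_two_large[OF k(2)])
      show "\<phi> ` set vs \<noteq> {}" using vs by (auto simp: closed_path_def)
      fix x assume "x \<in> \<phi> ` set vs"
      then obtain v where v: "v \<in> set vs" "x = \<phi> v" by blast
      obtain a c where ac: "a \<in> set vs" "c \<in> set vs" "a \<noteq> c" "(v, a) \<in> parcs H" "(v, c) \<in> parcs H"
        using closed_path_two_neighbours[OF vs symH v(1)] by metis
      have "\<phi> a \<noteq> \<phi> c" using \<phi>(1) ac sub by (meson inj_onD subsetD)
      moreover have "star_path_adj False k x (\<phi> a)" "star_path_adj False k x (\<phi> c)"
        using \<phi>(2)[of v a] \<phi>(2)[of v c] ac v sub by auto
      ultimately show "\<exists>y\<in>\<phi> ` set vs. \<exists>z\<in>\<phi> ` set vs. y \<noteq> z \<and> star_path_adj False k x y \<and> star_path_adj False k x z"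
        using ac(1,2) by blast
    qed simp
    also have "card (\<phi> ` set vs) \<le> card (\<phi> ` pverts H)"
      using sub pair_graphD(1)[OF H] by (intro card_mono) auto
    also have "\<dots> = card (pverts H)" using \<phi>(1) by (rule card_image)
    finally show False using k(1) by simp
  qed
  then show ?thesis
    using pair_graph_star_path_graph by (auto simp: free_class_def contains_induced_def)
qed

text \<open>The two branch vertices land on different centres, at least \<open>k\<close> positions
  apart, and a walk between them needs more vertices than \<open>H\<close> has.\<close>

lemma star_path_graph_free_of_double_branch:
  assumes H: "pair_graph H" and k: "card (pverts H) \<le> k" "2 \<le> k"
    and forest: "undirected_forest (with_proj H)"
    and uv: "u \<noteq> v" "3 \<le> card (parcs H `` {u})" "3 \<le> card (parcs H `` {v})"
    and reach: "(u, v) \<in> rtrancl_on (pverts H) (parcs H)"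
  shows "star_path_graph True k n \<in> free_class H"
proof -
  have False
    if I: "induced_subgraph I (with_proj (star_path_graph True k n))" "digraph_iso (with_proj H) I" for I
  proof -
    obtain \<phi> where \<phi>: "inj_on \<phi> (pverts H)"
        "\<And>u v. u \<in> pverts H \<Longrightarrow> v \<in> pverts H \<Longrightarrow> (u, v) \<in> parcs H \<longleftrightarrow> star_path_adj True k (\<phi> u) (\<phi> v)"
      by (rule star_path_graph_embedding[OF I]) blast
    have V: "u \<in> pverts H" "v \<in> pverts H" using in_rtrancl_on_in_F[OF reach] by auto
    have 0: "fst (\<phi> u) = 0" "fst (\<phi> v) = 0"
      using star_path_branch_is_centre[OF H k(2) forest \<phi>] V uv by auto
    define g where "g x = star_path_pos k (\<phi> x)" for x
    have g: "g x = k * snd (\<phi> x)" if "x \<in> {u, v}" for x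
      using that 0 by (auto simp: g_def star_path_pos_def)
    \<comment> \<open>The walk meets all \<open>k + 1\<close> positions from \<open>g x\<close> to
      \<open>g x + k\<close>, each at a different vertex.\<close>
    have large: False if "(x, y) \<in> rtrancl_on (pverts H) (parcs H)" "g x + k \<le> g y" for x y
    proof -
      have "{g x..g x + k} \<subseteq> g ` pverts H"
      proof
        fix q assume q: "q \<in> {g x..g x + k}"
        show "q \<in> g ` pverts H"
          by (rule rtrancl_on_hits_intermediate[OF that(1)])
             (use \<phi>(2) star_path_pos_adj q that(2) in \<open>auto simp: g_def\<close>)
      qed
      then have "card {g x..g x + k} \<le> card (g ` pverts H)"
        using pair_graphD(1)[OF H] by (intro card_mono) auto
      also have "\<dots> \<le> card (pverts H)" using pair_graphD(1)[OF H] by (rule card_image_le)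
      finally show False using k by simp
    qed
    have "snd (\<phi> u) \<noteq> snd (\<phi> v)"
    proof
      assume "snd (\<phi> u) = snd (\<phi> v)"
      then have "\<phi> u = \<phi> v" using 0 by (simp add: prod_eq_iff)
      then show False using inj_onD[OF \<phi>(1)] V uv(1) by blast
    qed
    moreover have gap: "k * a + k \<le> k * c" if "a < c" for a c
      using mult_le_mono2[of "Suc a" c k] that by simp
    ultimately consider "g u + k \<le> g v" | "g v + k \<le> g u"
      using gap[of "snd (\<phi> u)" "snd (\<phi> v)"] gap[of "snd (\<phi> v)" "snd (\<phi> u)"] g by (auto simp: linorder_neq_iff)
    then show False
    proof cases
      case 1
      then show False using large reach by blast
    next
      case 2
      have "sym (parcs H)" using pair_graphD(6)[OF H] by (auto simp: sym_def)
      then have "sym (rtrancl_on (pverts H) (parcs H))" by (rule rtrancl_on_sym)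
      then have "(v, u) \<in> rtrancl_on (pverts H) (parcs H)" using reach by (rule symD)
      then show False using large 2 by blast
    qed
  qed
  then show ?thesis
    using pair_graph_star_path_graph by (auto simp: free_class_def contains_induced_def)
qed

text \<open>A cycle of a component is a cycle of the whole graph, and strong connectivity implies
  connectivity.\<close>

lemma forest_component_tree:
  assumes forest: "undirected_forest (with_proj H)" and C: "C \<in> pre_digraph.sccs (with_proj H)"
  shows "undirected_tree C"
proof -
  have ind: "induced_subgraph C (with_proj H)" and sc: "strongly_connected C"
    using C by (auto simp: pre_digraph.sccs_def)
  have comp: "compatible (with_proj H) C" and sub: "verts C \<subseteq> pverts H" "arcs C \<subseteq> parcs H"
    using ind by (auto simp: induced_subgraph_def subgraph_def)
  have "Digraph_Component.connected C"
    unfolding connected_conv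
  proof (intro conjI ballI)
    show "verts C \<noteq> {}" using sc by (simp add: strongly_connected_def)
    fix u v assume "u \<in> verts C" "v \<in> verts C"
    then have reach: "(u, v) \<in> rtrancl_on (verts C) (arcs_ends C)"
      using sc by (auto simp: strongly_connected_def reachable_def)
    have "arcs_ends C \<subseteq> (arcs_ends C)\<^sup>s" by (auto simp: symcl_def)
    then show "(u, v) \<in> rtrancl_on (verts C) ((arcs_ends C)\<^sup>s)"
      using order_refl reach by (rule rtrancl_on_mono)
  qed
  moreover have "pre_digraph.cycle (with_proj H) p" if "pre_digraph.cycle C p" for p
    using that sub unfolding pre_digraph.cycle_def pre_digraph.awalk_def
      compatible_cas[OF comp] compatible_awalk_verts[OF comp] by auto
  ultimately show ?thesis using forest by (auto simp: undirected_tree_def undirected_forest_def)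
qed

theorem theorem3p3:
  fixes H :: "'a pair_pre_digraph"
  assumes "pair_graph H"
    and "clean_class (free_class H)"
  shows "subdivided_star_forest (with_proj H)"
proof (rule ccontr)
  assume neg: "\<not> subdivided_star_forest (with_proj H)"
  note H = assms(1)
  \<comment> \<open>Adding 2 secures \<open>2 <= k\<close> even for very small
    \<open>H\<close>.\<close>
  define k where "k = card (pverts H) + 2"
  have k: "card (pverts H) \<le> k" "2 \<le> k" by (auto simp: k_def)
  have "\<exists>b. \<forall>n. star_path_graph b k n \<in> free_class H"
  proof (cases "undirected_forest (with_proj H)")
    case False
    then show ?thesis using star_path_graph_free_of_cycle[OF H k] by blast
  next
    case True
    \<comment> \<open>Components of a forest are trees, so only the bound on branch vertices can
      fail.\<close>
    then obtain C where C: "C \<in> pre_digraph.sccs (with_proj H)"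
        "\<not> card {v \<in> verts C. 2 < out_degree C v} \<le> Suc 0"
      using neg forest_component_tree[OF True] by (auto simp: subdivided_star_forest_def)
    have ind: "induced_subgraph C (with_proj H)" and sc: "strongly_connected C"
      using C(1) by (auto simp: pre_digraph.sccs_def)
    have sub: "verts C \<subseteq> pverts H" "arcs C \<subseteq> parcs H" "tail C = fst" "head C = snd"
      using ind by (auto simp: induced_subgraph_def subgraph_def compatible_def)
    have "finite {v \<in> verts C. 2 < out_degree C v}"
      using sub(1) pair_graphD(1)[OF H] by (auto intro: finite_subset)
    then obtain u v where uv: "u \<noteq> v" "u \<in> verts C" "v \<in> verts C" "2 < out_degree C u" "2 < out_degree C v"
      using C(2) by (auto simp: card_le_Suc0_iff_eq)
    have deg: "3 \<le> card (parcs H `` {x})" if "2 < out_degree C x" for x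
    proof -
      \<comment> \<open>Arcs leaving \<open>x\<close> are pairs, so they are determined by their
        heads.\<close>
      have "out_degree C x = card (snd ` out_arcs C x)"
        unfolding out_degree_def
        by (intro card_image[symmetric]) (auto simp: inj_on_def out_arcs_def sub)
      also have "\<dots> \<le> card (parcs H `` {x})"
        using pair_graphD(3)[OF H] sub by (intro card_mono) (auto simp: out_arcs_def)
      finally show ?thesis using that by simp
    qed
    have reach: "(u, v) \<in> rtrancl_on (verts C) (arcs_ends C)"
      using sc uv by (auto simp: strongly_connected_def reachable_def)
    have "arcs_ends C \<subseteq> parcs H" using sub by (auto simp: arcs_ends_conv)
    then have "(u, v) \<in> rtrancl_on (pverts H) (parcs H)"
      using sub(1) reach by (rule rtrancl_on_mono)
    then show ?thesis
      using star_path_graph_free_of_double_branch[OF H k True uv(1) deg[OF uv(4)] deg[OF uv(5)]] by blast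
  qed
  then obtain b where free: "\<And>n. star_path_graph b k n \<in> free_class H" by blast
  obtain w where "\<And>G. G \<in> free_class H \<Longrightarrow> t_clean 23 (with_proj G) \<Longrightarrow> treewidth G \<le> w"
    using assms(2) unfolding clean_class_def by (metis one_le_numeral)
  \<comment> \<open>The bound \<open>w\<close> is for the fixed value 23, while \<open>n\<close> is
    still free; this choice makes the treewidth at least \<open>Suc w\<close>.\<close>
  then have "treewidth (star_path_graph b k (Suc (Suc w))) \<le> w"
    using free star_path_graph_clean[OF k(2)] by blast
  then show False using treewidth_star_path_graph[of "Suc w" b k] by simp
qed

end
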